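(* Let $1\le p<\infty$ and let $\mu$ be a measure on $\mathbf{R}$. Then the following are equivalent: (i) $\mu$ is locally $p$-admissible; (ii) $d\mu=w\,dx$, where $w$ is a local $A_p$ weight; (iii) $d\mu=w\,dx$, and for each bounded interval $I\subset\mathbf{R}$ there is a global $A_p$ weight $\widetilde{w}$ on $\mathbf{R}$ such that $\widetilde{w}=w$ on $I$.
   Context: A measure on $\mathbf{R}$ means a positive complete Borel measure $\mu$ with $0<\mu(B)<\infty$ for every ball $B$. Balls $B=B(x,r)$ in $\mathbf{R}$ are the bounded open intervals $(x-r,x+r)$, with radius $r_B=r$, and $\lambda B=B(x,\lambda r)$. A weight is a nonnegative measurable function. Write $u_B=\frac{1}{\mu(B)}\int_B u\,d\mu$. Upper gradient: a Borel function $g\ge 0$ on a metric space $Y$ is an upper gradient of $u:Y\to[-\infty,\infty]$ if $|u(\gamma(0))-u(\gamma(l_\gamma))|\le\int_\gamma g\,ds$ for every nonconstant compact rectifiable curve $\gamma:[0,l_\gamma]\to Y$ parameterized by arc length (the left-hand side is interpreted as $\infty$ if at least one of the two terms is $\pm\infty$). Let $B_0$ be a ball in $\mathbf{R}$. - $\mu$ is doubling within $B_0$ if there is $C>0$ such that $\mu(2B)\le C\mu(B)$ for all balls $B\subset B_0$. - The $p$-Poincaré inequality holds within $B_0$ if there are $C>0$ and $\lambda\ge1$ such that for all balls $B\subset B_0$, all integrable functions $u$ on $\lambda B$ and all upper gradients $g$ of $u$ on $\lambda B$, $$\frac{1}{\mu(B)}\int_B|u-u_B|\,d\mu\le C r_B\Bigl(\frac{1}{\mu(\lambda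 B)}\int_{\lambda B}g^p\,d\mu\Bigr)^{1/p}.$$ - $\mu$ is $p$-admissible within $B_0$ if it is doubling and supports a $p$-Poincaré inequality within $B_0$. - $w$ is an $A_p$ weight within $B_0$ if there is $C>0$ such that for all balls $B\subset B_0$, $\frac{1}{|B|}\int_B w\,dx< C\bigl(\frac{1}{|B|}\int_B w^{1/(1-p)}\,dx\bigr)^{1-p}$ if $p>1$, and $\frac{1}{|B|}\int_B w\,dx< C\operatorname{ess\,inf}_B w$ if $p=1$. Such a property is local if for every $x\in\mathbf{R}$ there is $R_x>0$ such that it holds within $B(x,R_x)$, with constants that may depend on $x$. It is global if it holds within every ball $B_0\subset\mathbf{R}$ with constants independent of $B_0$. *)

theory Defs
  imports "HOL-Analysis.Analysis"
begin

text \<open>Real powers on [0,\<infinity>] with the conventions of measure theory: for a < 0 one has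
  0^a = \<infinity> and \<infinity>^a = 0 (whereas the real-valued operator gives \<open>0 powr a = 0\<close>).\<close>

definition enn_powr :: "ennreal \<Rightarrow> real \<Rightarrow> ennreal" where
  "enn_powr x a =
     (if a = 0 then 1
      else if x = 0 then (if a > 0 then 0 else \<infinity>)
      else if x = \<infinity> then (if a > 0 then \<infinity> else 0)
      else ennreal (enn2real x powr a))"

text \<open>The distance between two values of an extended real-valued function, which is \<open>\<infinity>\<close>
  as soon as one of the values is infinite.\<close>

definition ext_diff :: "ereal \<Rightarrow> ereal \<Rightarrow> ennreal" where
  "ext_diff a b =
     (if \<bar>a\<bar> = \<infinity> \<or> \<bar>b\<bar> = \<infinity> then \<infinity>
      else ennreal \<bar>real_of_ereal a - real_of_ereal b\<bar>)"

definition ess_inf_on :: "'a measure \<Rightarrow> 'a set \<Rightarrow> ('a \<Rightarrow> ennreal) \<Rightarrow> ennreal" where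
  "ess_inf_on M B f = Sup {c. AE x in M. x \<in> B \<longrightarrow> c \<le> f x}"

definition curve_length :: "(real \<Rightarrow> 'a::metric_space) \<Rightarrow> real \<Rightarrow> real \<Rightarrow> ennreal" where
  "curve_length \<gamma> a b =
     (SUP ts \<in> {ts. sorted ts \<and> set ts \<subseteq> {a..b}}.
        \<Sum>i<length ts - 1. ennreal (dist (\<gamma> (ts ! i)) (\<gamma> (ts ! Suc i))))"

text \<open>Nonconstant compact rectifiable curves \<open>\<gamma> : [0,l] \<rightarrow> Y\<close> parameterized by arc length.
  Rectifiability and \<open>l = l\<^sub>\<gamma>\<close> are the last conjunct at \<open>t = l\<close>; nonconstancy is \<open>0 < l\<close>.\<close>

definition arc_length_curve :: "'a::metric_space set \<Rightarrow> real \<Rightarrow> (real \<Rightarrow> 'a) \<Rightarrow> bool" where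
  "arc_length_curve Y l \<gamma> \<longleftrightarrow>
     0 < l \<and> continuous_on {0..l} \<gamma> \<and> \<gamma> ` {0..l} \<subseteq> Y \<and>
     (\<forall>t\<in>{0..l}. curve_length \<gamma> 0 t = ennreal t)"

text \<open>Here \<open>Y\<close> is regarded as a metric space in its own right; \<open>u\<close> and \<open>g\<close> matter only on \<open>Y\<close>.\<close>

definition upper_gradient ::
  "'a::metric_space set \<Rightarrow> ('a \<Rightarrow> ereal) \<Rightarrow> ('a \<Rightarrow> ennreal) \<Rightarrow> bool" where
  "upper_gradient Y u g \<longleftrightarrow>
     g \<in> borel_measurable (restrict_space borel Y) \<and>
     (\<forall>l \<gamma>. arc_length_curve Y l \<gamma> \<longrightarrow>
        ext_diff (u (\<gamma> 0)) (u (\<gamma> l)) \<le> (\<integral>\<^sup>+t\<in>{0..l}. g (\<gamma> t) \<partial>lborel))"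

text \<open>A complete Borel measure is the completion of a measure on the Borel sets.\<close>

definition line_measure :: "real measure \<Rightarrow> bool" where
  "line_measure M \<longleftrightarrow>
     (\<exists>N. sets N = sets borel \<and> M = completion N) \<and>
     (\<forall>x r. 0 < r \<longrightarrow> 0 < emeasure M (ball x r) \<and> emeasure M (ball x r) < \<infinity>)"

definition weight :: "(real \<Rightarrow> ennreal) \<Rightarrow> bool" where
  "weight w \<longleftrightarrow> w \<in> borel_measurable lebesgue"

text \<open>The relation \<open>d\<mu> = w dx\<close>. The completion accounts for a weight that vanishes
  on a set of positive Lebesgue measure, since \<open>\<mu>\<close> is complete.\<close>

definition has_weight :: "real measure \<Rightarrow> (real \<Rightarrow> ennreal) \<Rightarrow> bool" where
  "has_weight M w \<longleftrightarrow> M = completion (density lebesgue w)"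

definition doubling_with :: "real \<Rightarrow> real measure \<Rightarrow> real set \<Rightarrow> bool" where
  "doubling_with C M B0 \<longleftrightarrow>
     (\<forall>x r. 0 < r \<and> ball x r \<subseteq> B0 \<longrightarrow>
        emeasure M (ball x (2 * r)) \<le> ennreal C * emeasure M (ball x r))"

definition integrable_ext :: "real measure \<Rightarrow> real set \<Rightarrow> (real \<Rightarrow> ereal) \<Rightarrow> bool" where
  "integrable_ext M Y u \<longleftrightarrow>
     u \<in> borel_measurable (restrict_space M Y) \<and> (\<integral>\<^sup>+x\<in>Y. e2ennreal \<bar>u x\<bar> \<partial>M) < \<infinity>"

text \<open>The mean value of an integrable function; such a function is finite almost everywhere,
  so that the values at which \<open>real_of_ereal\<close> is not faithful do not contribute.\<close>

definition mean_value :: "real measure \<Rightarrow> real set \<Rightarrow> (real \<Rightarrow> ereal) \<Rightarrow> real" where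
  "mean_value M B u = (LINT x:B|M. real_of_ereal (u x)) / measure M B"

definition poincare_with ::
  "real \<Rightarrow> real \<Rightarrow> real \<Rightarrow> real measure \<Rightarrow> real set \<Rightarrow> bool" where
  "poincare_with C L p M B0 \<longleftrightarrow>
     (\<forall>x r. 0 < r \<and> ball x r \<subseteq> B0 \<longrightarrow>
        (\<forall>u g. integrable_ext M (ball x (L * r)) u \<and> upper_gradient (ball x (L * r)) u g \<longrightarrow>
           (\<integral>\<^sup>+y\<in>ball x r. ext_diff (u y) (ereal (mean_value M (ball x r) u)) \<partial>M)
               / emeasure M (ball x r)
           \<le> ennreal (C * r) *
             enn_powr ((\<integral>\<^sup>+y\<in>ball x (L * r). enn_powr (g y) p \<partial>M)
                        / emeasure M (ball x (L * r))) (1 / p)))"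

definition admissible_within :: "real \<Rightarrow> real measure \<Rightarrow> real set \<Rightarrow> bool" where
  "admissible_within p M B0 \<longleftrightarrow>
     (\<exists>C>0. doubling_with C M B0) \<and> (\<exists>C>0. \<exists>L\<ge>1. poincare_with C L p M B0)"

definition Ap_with :: "real \<Rightarrow> real \<Rightarrow> (real \<Rightarrow> ennreal) \<Rightarrow> real set \<Rightarrow> bool" where
  "Ap_with C p w B0 \<longleftrightarrow>
     (\<forall>x r. 0 < r \<and> ball x r \<subseteq> B0 \<longrightarrow>
        (\<integral>\<^sup>+y\<in>ball x r. w y \<partial>lebesgue) / emeasure lebesgue (ball x r)
        < ennreal C *
          (if p = 1 then ess_inf_on lebesgue (ball x r) w
           else enn_powr ((\<integral>\<^sup>+y\<in>ball x r. enn_powr (w y) (1 / (1 - p)) \<partial>lebesgue)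
                           / emeasure lebesgue (ball x r)) (1 - p)))"

definition holds_locally :: "(real set \<Rightarrow> bool) \<Rightarrow> bool" where
  "holds_locally P \<longleftrightarrow> (\<forall>x. \<exists>R>0. P (ball x R))"

definition locally_admissible :: "real \<Rightarrow> real measure \<Rightarrow> bool" where
  "locally_admissible p M \<longleftrightarrow> holds_locally (admissible_within p M)"

definition local_Ap_weight :: "real \<Rightarrow> (real \<Rightarrow> ennreal) \<Rightarrow> bool" where
  "local_Ap_weight p w \<longleftrightarrow> weight w \<and> holds_locally (\<lambda>B0. \<exists>C>0. Ap_with C p w B0)"

definition global_Ap_weight :: "real \<Rightarrow> (real \<Rightarrow> ennreal) \<Rightarrow> bool" where
  "global_Ap_weight p w \<longleftrightarrow> weight w \<and> (\<exists>C>0. \<forall>x R. 0 < R \<longrightarrow> Ap_with C p w (ball x R))"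

end

theory Submission
  imports Defs
begin

text \<open>
  All three conditions are compared with the bound
  \<open>1/|B| \<integral>\<^sub>B g dx \<le> C (1/\<mu>(B) \<integral>\<^sub>B g\<^sup>p d\<mu>)\<^bsup>1/p\<^esup>\<close> for Borel functions \<open>g \<ge> 0\<close> on small balls \<open>B\<close>.

  If \<open>\<mu>\<close> is locally admissible, apply the Poincare inequality on \<open>3B\<close> to an antiderivative of \<open>g 1\<^sub>B\<close>: it
  is constant on the left and right thirds of \<open>3B\<close>, whose measures are comparable to that of \<open>3B\<close> by
  doubling, so its mean oscillation is at least a multiple of \<open>\<integral>\<^sub>B g dx\<close>. Taking for \<open>g\<close> the
  indicator of the complement of a Lebesgue null set \<open>E\<close> gives \<open>\<mu>(B) \<le> C \<mu>(B - E)\<close> for all small \<open>B\<close>,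
  hence \<open>\<mu>(E) = 0\<close>; taking truncations of \<open>w\<^bsup>1/(1-p)\<^esup>\<close> (for \<open>p = 1\<close>: indicators of sublevel sets of \<open>w\<close>)
  gives the Muckenhoupt condition.

  Conversely the Muckenhoupt condition implies the bound by a form of the Hoelder inequality. For
  \<open>g = 1\<^sub>A\<close> the bound is doubling, and for an upper gradient \<open>g\<close> of \<open>u\<close> it is the Poincare inequality,
  because \<open>u\<close> oscillates on the interval \<open>B\<close> by at most \<open>\<integral>\<^sub>B g dx\<close>.

  A local \<open>A\<^sub>p\<close> weight is extended from \<open>I\<close> by cutting it off at points \<open>a\<close>, \<open>b\<close> outside \<open>I\<close> at which the
  one-sided averages of \<open>w\<close> and \<open>w\<^bsup>1/(1-p)\<^esup>\<close> are bounded, and continuing it by the constant 1.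
\<close>

section \<open>Comparison of measures on the line\<close>

lemma open_interval_is_ball:
  fixes c :: "real set"
  assumes "open c" "connected c" "bounded c" "c \<noteq> {}"
  obtains x r where "0 < r" "c = ball x r"
proof -
  have int: "is_interval c" by (simp add: assms is_interval_connected_1)
  have bdd: "bdd_above c" "bdd_below c"
    using assms bounded_imp_bdd_above bounded_imp_bdd_below by auto
  define a b where "a = Inf c" and "b = Sup c"
  have eq: "c = {a<..<b}"
  proof (intro set_eqI iffI)
    fix x assume x: "x \<in> c"
    obtain e where e: "0 < e" "ball x e \<subseteq> c" using \<open>open c\<close> x openE by blast
    then have "x - e/2 \<in> c" "x + e/2 \<in> c" by (auto simp: subset_iff dist_real_def)
    then have "a \<le> x - e/2" "x + e/2 \<le> b"
      unfolding a_def b_def using bdd by (auto intro: cInf_lower cSup_upper)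
    then show "x \<in> {a<..<b}" using e by auto
  next
    fix x assume x: "x \<in> {a<..<b}"
    obtain y where y: "y \<in> c" "y < x"
      using x bdd assms cInf_less_iff[of c x] by (auto simp: a_def)
    obtain z where z: "z \<in> c" "x < z"
      using x bdd assms less_cSup_iff[of c x] by (auto simp: b_def)
    show "x \<in> c" by (rule mem_is_interval_1_I[OF int y(1) z(1)]) (use y z in auto)
  qed
  then have "a < b" using \<open>c \<noteq> {}\<close> by auto
  have "c = ball ((a+b)/2) ((b-a)/2)"
    unfolding eq by (simp add: ball_eq_greaterThanLessThan field_simps)
  then show ?thesis using \<open>a < b\<close> that[of "(b-a)/2" "(a+b)/2"] by auto
qed

text \<open>Outer regularity reduces the claim to open sets, and an open subset of the line is the
  countable disjoint union of its components; those inside \<open>ball x0 R\<close> are themselves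
  balls.\<close>

lemma emeasure_le_of_balls:
  fixes N1 N2 :: "real measure"
  assumes s1: "sets N1 = sets borel" and s2: "sets N2 = sets borel"
    and fin: "emeasure N2 (ball x0 R) < \<infinity>"
    and le: "\<And>x r. 0 < r \<Longrightarrow> ball x r \<subseteq> ball x0 R \<Longrightarrow> emeasure N1 (ball x r) \<le> emeasure N2 (ball x r)"
    and A: "A \<in> sets borel" "A \<subseteq> ball x0 R"
  shows "emeasure N1 A \<le> emeasure N2 A"
proof -
  note [measurable_cong] = s1 s2
  have [measurable]: "A \<in> sets borel" using A by simp
  \<comment> \<open>\<open>outer_regular\<close> is applied to \<open>N2\<close> restricted to the
    ball, which is a finite measure; \<open>N2\<close> is assumed finite only on that ball.\<close>
  define N where "N = density N2 (indicator (ball x0 R))"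
  have sN: "sets N = sets borel" by (simp add: N_def s2)
  have eN: "emeasure N U = emeasure N2 (U \<inter> ball x0 R)" if [measurable]: "U \<in> sets borel" for U
    unfolding N_def by (subst emeasure_density)
      (auto simp: indicator_inter_arith[symmetric] Int_commute s2 intro!: borel_measurable_indicator)
  have "emeasure N1 A \<le> emeasure N2 (U \<inter> ball x0 R)" if U: "open U" "A \<subseteq> U" for U
  proof -
    let ?V = "U \<inter> ball x0 R"
    have V: "open ?V" using U by auto
    let ?K = "components ?V"
    have disj: "disjoint_family_on (\<lambda>c. c) ?K"
      using components_nonoverlap by (fastforce simp: disjoint_family_on_def)
    have cnt: "countable ?K"
    proof (rule countable_disjoint_open_subsets)
      show "disjoint ?K" using components_nonoverlap by (fastforce simp: disjoint_def)
    qed (use V open_components in blast)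
    have op: "open c" if "c \<in> ?K" for c using open_components V that by blast
    have comp_ball: "\<exists>x r. 0 < r \<and> c = ball x r" if c: "c \<in> ?K" for c
    proof -
      have "connected c" "c \<noteq> {}" using c in_components_connected in_components_nonempty by auto
      have "bounded c" using c in_components_subset bounded_subset[OF bounded_ball] by (metis Int_subset_iff)
      then show ?thesis
        using open_interval_is_ball[of c] op[OF c] \<open>connected c\<close> \<open>c \<noteq> {}\<close> by metis
    qed
    have un: "?V = (\<Union>c\<in>?K. c)" by (metis Union_components image_ident)
    have "emeasure N1 A \<le> emeasure N1 ?V"
      using A U V by (intro emeasure_mono) (auto simp: s1)
    also have "\<dots> = (\<integral>\<^sup>+c. emeasure N1 c \<partial>count_space ?K)"
      using emeasure_UN_countable[OF _ cnt disj, of N1] op un by (auto simp: s1)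
    also have "\<dots> \<le> (\<integral>\<^sup>+c. emeasure N2 c \<partial>count_space ?K)"
    proof (intro nn_integral_mono)
      fix c assume "c \<in> space (count_space ?K)"
      then have c: "c \<in> ?K" by simp
      then have "c \<subseteq> ball x0 R" using in_components_subset by blast
      then show "emeasure N1 c \<le> emeasure N2 c" using comp_ball[OF c] le by auto
    qed
    also have "\<dots> = emeasure N2 ?V"
      using emeasure_UN_countable[OF _ cnt disj, of N2] op un by (auto simp: s2)
    finally show ?thesis .
  qed
  then have "emeasure N1 A \<le> (INF U\<in>{U. A \<subseteq> U \<and> open U}. emeasure N U)"
    by (intro INF_greatest) (auto simp: eN)
  also have "\<dots> = emeasure N A"
    by (rule outer_regular[symmetric]) (use fin in \<open>auto simp: sN eN sets_eq_imp_space_eq[OF sN]\<close>)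
  also have "\<dots> = emeasure N2 A" using A by (simp add: eN Int_absorb2)
  finally show ?thesis .
qed

text \<open>Restricted to the ball, the two measures are comparable on every Borel set, so they are
  ordered as measures, and \<open>nn_integral\<close> is monotone in the measure.\<close>

lemma nn_integral_le_of_balls:
  fixes N1 N2 :: "real measure"
  assumes s1: "sets N1 = sets borel" and s2: "sets N2 = sets borel"
    and fin: "emeasure N2 (ball x0 R) < \<infinity>"
    and le: "\<And>x r. 0 < r \<Longrightarrow> ball x r \<subseteq> ball x0 R \<Longrightarrow> emeasure N1 (ball x r) \<le> emeasure N2 (ball x r)"
    and f: "f \<in> borel_measurable borel"
  shows "(\<integral>\<^sup>+x\<in>ball x0 R. f x \<partial>N1) \<le> (\<integral>\<^sup>+x\<in>ball x0 R. f x \<partial>N2)"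
proof -
  let ?D = "\<lambda>N. density N (indicator (ball x0 R))"
  have D: "emeasure (?D N) A = emeasure N (A \<inter> ball x0 R)"
    if s: "sets N = sets borel" and A: "A \<in> sets borel" for A and N :: "real measure"
  proof -
    have "emeasure (?D N) A = (\<integral>\<^sup>+x. indicator (A \<inter> ball x0 R) x \<partial>N)"
      by (subst emeasure_density)
        (auto simp: indicator_inter_arith[symmetric] Int_commute s A intro!: borel_measurable_indicator)
    also have "\<dots> = emeasure N (A \<inter> ball x0 R)"
      by (rule nn_integral_indicator) (use A s in auto)
    finally show ?thesis .
  qed
  have I: "(\<integral>\<^sup>+x\<in>ball x0 R. f x \<partial>N) = nn_integral (?D N) f"
    if s: "sets N = sets borel" for N :: "real measure"
    by (subst nn_integral_density)
      (use f in \<open>auto simp: s mult.commute measurable_cong_sets[OF s refl] intro!: borel_measurable_indicator\<close>)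
  have "emeasure (?D N1) A \<le> emeasure (?D N2) A" if "A \<in> sets borel" for A
    using that emeasure_le_of_balls[OF s1 s2 fin le, of "A \<inter> ball x0 R"] by (simp add: D s1 s2)
  then have "?D N1 \<le> ?D N2"
    by (subst le_measure) (simp_all add: s1 s2)
  then have "nn_integral (?D N1) f \<le> nn_integral (?D N2) f"
    by (intro nn_integral_mono_measure) (simp_all add: s1 s2)
  then show ?thesis by (simp add: I s1 s2)
qed

section \<open>Curves and upper gradients on the line\<close>

text \<open>A partition of \<open>[0, s]\<close> followed by the points \<open>s\<close> and
  \<open>t\<close> is a partition of \<open>[0, t]\<close>. Hence the length up to \<open>t\<close>,
  which is \<open>t\<close>, is at least \<open>s\<close> plus the distance of the two curve
  points.\<close>

lemma arc_length_curve_lipschitz: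
  assumes arc: "arc_length_curve Y l \<gamma>" and st: "0 \<le> s" "s \<le> t" "t \<le> l"
  shows "dist (\<gamma> s) (\<gamma> t) \<le> t - s"
proof -
  define S where "S ts = (\<Sum>i<length ts - 1. ennreal (dist (\<gamma> (ts ! i)) (\<gamma> (ts ! Suc i))))" for ts
  define P where "P a = {ts. sorted ts \<and> set ts \<subseteq> {0..a}}" for a :: real
  have len: "curve_length \<gamma> 0 a = (SUP ts\<in>P a. S ts)" for a
    by (simp add: curve_length_def S_def P_def)
  have len_eq: "curve_length \<gamma> 0 a = ennreal a" if "0 \<le> a" "a \<le> l" for a
    using arc that by (auto simp: arc_length_curve_def)
  \<comment> \<open>A partition of \<open>[0, s]\<close> need not end at \<open>s\<close>; appending
    \<open>s\<close> does not decrease its sum.\<close>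
  have snoc: "S (ts @ [a]) \<ge> S ts" for ts a
  proof -
    have "S ts = (\<Sum>i<length ts - 1. ennreal (dist (\<gamma> ((ts @ [a]) ! i)) (\<gamma> ((ts @ [a]) ! Suc i))))"
      unfolding S_def by (intro sum.cong) (auto simp: nth_append)
    also have "\<dots> \<le> S (ts @ [a])"
      unfolding S_def by (intro sum_mono2) auto
    finally show ?thesis .
  qed
  have "S ts + ennreal (dist (\<gamma> s) (\<gamma> t)) \<le> ennreal t" if "ts \<in> P s" for ts
  proof -
    have "S ts + ennreal (dist (\<gamma> s) (\<gamma> t)) \<le> S (ts @ [s]) + ennreal (dist (\<gamma> s) (\<gamma> t))"
      by (intro add_right_mono snoc)
    also have "\<dots> = (\<Sum>i<length ts. ennreal (dist (\<gamma> ((ts @ [s, t]) ! i)) (\<gamma> ((ts @ [s, t]) ! Suc i))))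
        + ennreal (dist (\<gamma> s) (\<gamma> t))"
      unfolding S_def by (intro arg_cong2[where f="(+)"] sum.cong) (auto simp: nth_append)
    also have "\<dots> = S (ts @ [s, t])"
      unfolding S_def by (simp add: nth_append)
    also have "\<dots> \<le> curve_length \<gamma> 0 t"
      unfolding len using that st by (intro SUP_upper) (auto simp: P_def sorted_append)
    finally show ?thesis using st len_eq[of t] by simp
  qed
  then have "(SUP ts\<in>P s. S ts + ennreal (dist (\<gamma> s) (\<gamma> t))) \<le> ennreal t"
    by (rule SUP_least)
  \<comment> \<open>Adding a constant commutes with a supremum over a nonempty set.\<close>
  moreover have "[] \<in> P s" by (simp add: P_def)
  ultimately have "curve_length \<gamma> 0 s + ennreal (dist (\<gamma> s) (\<gamma> t)) \<le> ennreal t"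
    unfolding len by (subst (asm) ennreal_SUP_add_left) auto
  then have "ennreal (s + dist (\<gamma> s) (\<gamma> t)) \<le> ennreal t"
    using st len_eq[of s] by simp
  then show ?thesis using st by (subst (asm) ennreal_le_iff) auto
qed

text \<open>Let \<open>t\<close> be the first time at which the curve reaches level \<open>d\<close>
  and \<open>s\<close> the last time before \<open>t\<close> at which it is at most
  \<open>c\<close>. Strictly between them it runs inside \<open>(c, d)\<close>, and the Lipschitz
  bound forces \<open>t - s\<close> to be at least \<open>d - c\<close>.\<close>

lemma emeasure_curve_preimage_ge_increasing:
  fixes \<gamma> :: "real \<Rightarrow> real"
  assumes cont: "continuous_on {0..l} \<gamma>"
    and lip: "\<And>s t. 0 \<le> s \<Longrightarrow> s \<le> t \<Longrightarrow> t \<le> l \<Longrightarrow> dist (\<gamma> s) (\<gamma> t) \<le> t - s"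
    and cd: "\<gamma> 0 \<le> c" "c < d" "d \<le> \<gamma> l" and l: "0 \<le> l"
  shows "ennreal (d - c) \<le> emeasure lborel (\<gamma> -` {c<..<d} \<inter> {0..l})"
proof -
  have cp: "compact ({0..m} \<inter> \<gamma> -` C)" if "closed C" "m \<le> l" for C m
  proof -
    have "closed ({0..m} \<inter> \<gamma> -` C)"
      using that by (intro continuous_closed_preimage continuous_on_subset[OF cont]) auto
    then show ?thesis
      using bounded_subset[of "{0..m}" "{0..m} \<inter> \<gamma> -` C"] by (simp add: compact_eq_bounded_closed)
  qed
  define T where "T = {0..l} \<inter> \<gamma> -` {d..}"
  have T: "compact T" "T \<noteq> {}"
    unfolding T_def using cd l by (auto intro!: cp)
  obtain t where t: "t \<in> T" "\<And>x. x \<in> T \<Longrightarrow> t \<le> x"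
    using compact_attains_inf[OF T] by blast
  define U where "U = {0..t} \<inter> \<gamma> -` {..c}"
  have tl: "0 \<le> t" "t \<le> l" "d \<le> \<gamma> t" using t by (auto simp: T_def)
  have U: "compact U" "U \<noteq> {}"
    unfolding U_def using cd tl by (auto intro!: cp)
  obtain s where s: "s \<in> U" "\<And>x. x \<in> U \<Longrightarrow> x \<le> s"
    using compact_attains_sup[OF U] by blast
  have st: "0 \<le> s" "s \<le> t" "\<gamma> s \<le> c" using s by (auto simp: U_def)
  have "{s<..<t} \<subseteq> \<gamma> -` {c<..<d} \<inter> {0..l}"
  proof
    fix x assume x: "x \<in> {s<..<t}"
    then have "x \<notin> U" "x \<notin> T" using s(2) t(2) by fastforce+
    then show "x \<in> \<gamma> -` {c<..<d} \<inter> {0..l}"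
      using x st tl by (auto simp: U_def T_def)
  qed
  moreover have "\<gamma> -` {c<..<d} \<inter> {0..l} \<in> sets lborel"
  proof -
    have "\<gamma> -` {c<..<d} \<inter> {0..l} = {0..l} - {0..l} \<inter> \<gamma> -` {..c} - {0..l} \<inter> \<gamma> -` {d..}" by auto
    also have "\<dots> \<in> sets borel"
      by (intro sets.Diff borel_closed compact_imp_closed[OF cp]) auto
    finally show ?thesis by simp
  qed
  ultimately have "emeasure lborel {s<..<t} \<le> emeasure lborel (\<gamma> -` {c<..<d} \<inter> {0..l})"
    by (intro emeasure_mono) auto
  moreover have "d - c \<le> t - s"
    using lip[OF st(1,2) tl(2)] st tl by (auto simp: dist_real_def)
  ultimately show ?thesis using st
    by (simp add: emeasure_lborel_Ioo) (meson ennreal_leI order_trans)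
qed

lemma emeasure_curve_preimage_ge:
  fixes \<gamma> :: "real \<Rightarrow> real"
  assumes cont: "continuous_on {0..l} \<gamma>"
    and lip: "\<And>s t. 0 \<le> s \<Longrightarrow> s \<le> t \<Longrightarrow> t \<le> l \<Longrightarrow> dist (\<gamma> s) (\<gamma> t) \<le> t - s"
    and cd: "min (\<gamma> 0) (\<gamma> l) \<le> c" "c < d" "d \<le> max (\<gamma> 0) (\<gamma> l)" and l: "0 \<le> l"
  shows "ennreal (d - c) \<le> emeasure lborel (\<gamma> -` {c<..<d} \<inter> {0..l})"
proof (cases "\<gamma> 0 \<le> \<gamma> l")
  case True
  then show ?thesis using assms by (intro emeasure_curve_preimage_ge_increasing) auto
next
  case False
  have "ennreal (- c - - d) \<le> emeasure lborel ((\<lambda>t. - \<gamma> t) -` {- d<..<- c} \<inter> {0..l})"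
    using False assms
    by (intro emeasure_curve_preimage_ge_increasing) (auto simp: dist_real_def abs_minus_commute intro: continuous_intros)
  also have "(\<lambda>t. - \<gamma> t) -` {- d<..<- c} \<inter> {0..l} = \<gamma> -` {c<..<d} \<inter> {0..l}" by auto
  finally show ?thesis by simp
qed

text \<open>The image \<open>\<nu>\<close> of Lebesgue measure on \<open>[0, l]\<close> under
  \<open>\<gamma>\<close> gives each ball between the end points at least its length, however often
  the curve turns back, so it dominates Lebesgue measure there.\<close>

lemma nn_integral_along_curve_ge:
  fixes \<gamma> :: "real \<Rightarrow> real"
  assumes arc: "arc_length_curve Y l \<gamma>" and f: "f \<in> borel_measurable borel"
  shows "(\<integral>\<^sup>+x\<in>{min (\<gamma> 0) (\<gamma> l)<..<max (\<gamma> 0) (\<gamma> l)}. f x \<partial>lborel) \<le> (\<integral>\<^sup>+t\<in>{0..l}. f (\<gamma> t) \<partial>lborel)"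
proof (cases "\<gamma> 0 = \<gamma> l")
  case False
  note [measurable] = f
  have l: "0 < l" and cont: "continuous_on {0..l} \<gamma>" using arc by (auto simp: arc_length_curve_def)
  note lip = arc_length_curve_lipschitz[OF arc]
  define a b where "a = min (\<gamma> 0) (\<gamma> l)" and "b = max (\<gamma> 0) (\<gamma> l)"
  have ab: "a < b" using False by (auto simp: a_def b_def)
  have m[measurable]: "\<gamma> \<in> borel_measurable (restrict_space lborel {0..l})"
    using borel_measurable_continuous_on_restrict[OF cont]
    by (subst measurable_cong_sets[OF sets_restrict_space_cong[OF sets_lborel] refl])
  define \<nu> where "\<nu> = distr (restrict_space lborel {0..l}) borel \<gamma>"
  have \<nu>: "emeasure \<nu> A = emeasure lborel (\<gamma> -` A \<inter> {0..l})" if "A \<in> sets borel" for A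
    unfolding \<nu>_def using that
    by (subst emeasure_distr) (auto simp: space_restrict_space emeasure_restrict_space)
  have ball: "{a<..<b} = ball ((a+b)/2) ((b-a)/2)"
    by (simp add: ball_eq_greaterThanLessThan field_simps)
  have "(\<integral>\<^sup>+x\<in>{a<..<b}. f x \<partial>lborel) \<le> (\<integral>\<^sup>+x\<in>{a<..<b}. f x \<partial>\<nu>)"
    unfolding ball
  proof (rule nn_integral_le_of_balls)
    show "emeasure \<nu> (ball ((a + b) / 2) ((b - a) / 2)) < \<infinity>"
    proof -
      have "emeasure \<nu> (ball ((a + b) / 2) ((b - a) / 2)) \<le> emeasure lborel {0..l}"
        by (subst \<nu>) (auto intro!: emeasure_mono)
      also have "\<dots> < \<infinity>" by (simp add: emeasure_lborel_Icc_eq)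
      finally show ?thesis .
    qed
    fix x r :: real assume r: "0 < r" and sub: "ball x r \<subseteq> ball ((a + b) / 2) ((b - a) / 2)"
    have x: "ball x r = {x-r<..<x+r}" by (rule ball_eq_greaterThanLessThan)
    have "a \<le> x - r" "x + r \<le> b"
      using sub r unfolding ball[symmetric] x by (auto simp: greaterThanLessThan_subseteq_greaterThanLessThan)
    then have "ennreal ((x+r) - (x-r)) \<le> emeasure lborel (\<gamma> -` {x-r<..<x+r} \<inter> {0..l})"
      using r l ab by (intro emeasure_curve_preimage_ge cont lip) (auto simp: a_def b_def)
    then show "emeasure lborel (ball x r) \<le> emeasure \<nu> (ball x r)"
      using r by (simp add: \<nu> x)
  qed (auto simp: \<nu>_def f)
  also have "\<dots> \<le> (\<integral>\<^sup>+x. f x \<partial>\<nu>)"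
    by (intro nn_integral_mono) (auto simp: indicator_def)
  also have "\<dots> = (\<integral>\<^sup>+t. f (\<gamma> t) \<partial>restrict_space lborel {0..l})"
    unfolding \<nu>_def by (rule nn_integral_distr) auto
  also have "\<dots> = (\<integral>\<^sup>+t\<in>{0..l}. f (\<gamma> t) \<partial>lborel)"
    by (rule nn_integral_restrict_space) auto
  finally show ?thesis by (simp add: a_def b_def)
qed simp

lemma curve_length_line:
  fixes y t :: real
  assumes t: "0 \<le> t"
  shows "curve_length (\<lambda>s. y + s) 0 t = ennreal t"
  unfolding curve_length_def
proof (rule antisym)
  show "(SUP ts\<in>{ts. sorted ts \<and> set ts \<subseteq> {0..t}}.
      \<Sum>i<length ts - 1. ennreal (dist (y + ts ! i) (y + ts ! Suc i))) \<le> ennreal t"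
  proof (rule SUP_least, safe)
    fix ts :: "real list" assume ts: "sorted ts" "set ts \<subseteq> {0..t}"
    show "(\<Sum>i<length ts - 1. ennreal (dist (y + ts ! i) (y + ts ! Suc i))) \<le> ennreal t"
    proof (cases "ts = []")
      case False
      have "(\<Sum>i<length ts - 1. ennreal (dist (y + ts ! i) (y + ts ! Suc i)))
          = (\<Sum>i<length ts - 1. ennreal (ts ! Suc i - ts ! i))"
      proof (intro sum.cong refl)
        fix i assume "i \<in> {..<length ts - 1}"
        then have "ts ! i \<le> ts ! Suc i" using ts by (intro sorted_nth_mono) auto
        then show "ennreal (dist (y + ts ! i) (y + ts ! Suc i)) = ennreal (ts ! Suc i - ts ! i)"
          by (simp add: dist_real_def)
      qed
      also have "\<dots> = ennreal (\<Sum>i<length ts - 1. ts ! Suc i - ts ! i)"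
        using ts by (intro sum_ennreal) (auto intro!: sorted_nth_mono)
      also have "(\<Sum>i<length ts - 1. ts ! Suc i - ts ! i) = ts ! (length ts - 1) - ts ! 0"
        by (rule sum_lessThan_telescope)
      also have "ts ! (length ts - 1) \<in> {0..t}" "ts ! 0 \<in> {0..t}"
        using ts(2) False by (auto intro!: subsetD[OF ts(2)] nth_mem simp del: atLeastAtMost_iff)
      then have "ennreal (ts ! (length ts - 1) - ts ! 0) \<le> ennreal t"
        by (intro ennreal_leI) auto
      finally show ?thesis .
    qed simp
  qed
  show "ennreal t \<le> (SUP ts\<in>{ts. sorted ts \<and> set ts \<subseteq> {0..t}}.
      \<Sum>i<length ts - 1. ennreal (dist (y + ts ! i) (y + ts ! Suc i)))"
    by (rule SUP_upper2[of "[0, t]"]) (use t in \<open>auto simp: dist_real_def\<close>)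
qed

lemma arc_length_curve_line:
  fixes y z :: real
  assumes "y < z" "{y..z} \<subseteq> Y"
  shows "arc_length_curve Y (z - y) (\<lambda>s. y + s)"
  using assms by (auto simp: arc_length_curve_def curve_length_line intro!: continuous_intros)

lemma ext_diff_commute: "ext_diff a b = ext_diff b a"
  by (auto simp: ext_diff_def abs_minus_commute)

text \<open>The segment from \<open>y\<close> to \<open>z\<close>, run at unit speed, is one of the
  curves in the definition of an upper gradient. For \<open>y = z\<close> this segment would be
  constant.\<close>

lemma ext_diff_upper_gradient_le:
  fixes x r :: real
  assumes ug: "upper_gradient (ball x r) u g" and yz: "y \<in> ball x r" "z \<in> ball x r" "y \<noteq> z"
  shows "ext_diff (u y) (u z) \<le> (\<integral>\<^sup>+t\<in>ball x r. g t \<partial>lborel)"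
proof -
  have *: "ext_diff (u y) (u z) \<le> (\<integral>\<^sup>+t\<in>ball x r. g t \<partial>lborel)"
    if yz: "y \<in> ball x r" "z \<in> ball x r" "y < z" for y z
  proof -
    \<comment> \<open>An upper gradient is Borel only on the ball; the cut-off is Borel on the whole
      line, so the integral can be translated.\<close>
    let ?g = "\<lambda>t. g t * indicator (ball x r) t"
    have [measurable]: "?g \<in> borel_measurable borel"
      using ug by (auto simp: upper_gradient_def borel_measurable_restrict_space_iff_ennreal)
    have sub: "{y..z} \<subseteq> ball x r" using yz by (auto simp: dist_real_def)
    have "ext_diff (u y) (u z) \<le> (\<integral>\<^sup>+t\<in>{0..z-y}. g (y + t) \<partial>lborel)"
      using ug arc_length_curve_line[OF yz(3) sub] unfolding upper_gradient_def by fastforce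
    also have "\<dots> = (\<integral>\<^sup>+t. ?g (y + 1 * t) * indicator {y..z} (y + 1 * t) \<partial>lborel)"
      using sub by (intro nn_integral_cong) (auto simp: indicator_def subset_iff)
    also have "\<dots> = (\<integral>\<^sup>+t. ?g t * indicator {y..z} t \<partial>lborel)"
      by (subst nn_integral_real_affine[of "\<lambda>t. ?g t * indicator {y..z} t" 1 y]) auto
    also have "\<dots> \<le> (\<integral>\<^sup>+t. ?g t \<partial>lborel)"
      by (intro nn_integral_mono) (auto simp: indicator_def)
    finally show ?thesis .
  qed
  show ?thesis
    using *[of y z] *[of z y] yz by (cases y z rule: linorder_cases) (auto simp: ext_diff_commute)
qed

text \<open>Since \<open>g\<close> is nonnegative, the values of the antiderivative at the ends of a
  curve differ by the integral of \<open>g\<close> over the interval between them, and by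
  \<open>nn_integral_along_curve_ge\<close> the integral along the curve is no smaller.\<close>

lemma upper_gradient_indefinite_integral:
  fixes g :: "real \<Rightarrow> real"
  assumes g[measurable]: "g \<in> borel_measurable borel" and int: "integrable lborel g" and pos: "\<And>t. 0 \<le> g t"
  shows "upper_gradient Y (\<lambda>y. ereal (LINT t:{..y}|lborel. g t)) (\<lambda>y. ennreal (g y))"
  unfolding upper_gradient_def
proof (intro conjI allI impI)
  show "(\<lambda>y. ennreal (g y)) \<in> borel_measurable (restrict_space borel Y)"
    by (intro measurable_restrict_space1) measurable
  fix l \<gamma> assume arc: "arc_length_curve Y l \<gamma>"
  define u where "u y = (LINT t:{..y}|lborel. g t)" for y
  have si: "set_integrable lborel A g" if "A \<in> sets borel" for A
    by (rule set_integrable_subset[of lborel UNIV g]) (use that in \<open>auto simp: set_integrable_def int\<close>)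
  have diff: "ennreal \<bar>u a - u b\<bar> = (\<integral>\<^sup>+x\<in>{a<..<b}. ennreal (g x) \<partial>lborel)" if "a \<le> b" for a b
  proof -
    have "{..b} = {..a} \<union> {a<..b}" using that by auto
    then have "u b = u a + (LINT t:{a<..b}|lborel. g t)"
      unfolding u_def using si[of "{..a}"] si[of "{a<..b}"] by (simp only:) (rule set_integral_Un, auto)
    moreover have "0 \<le> (LINT t:{a<..b}|lborel. g t)"
      unfolding set_lebesgue_integral_def by (intro integral_nonneg_AE) (auto simp: pos)
    ultimately have "ennreal \<bar>u a - u b\<bar> = ennreal (LINT t:{a<..b}|lborel. g t)" by simp
    also have "\<dots> = (\<integral>\<^sup>+x. ennreal (indicator {a<..b} x *\<^sub>R g x) \<partial>lborel)"
      using si[of "{a<..b}"] unfolding set_lebesgue_integral_def set_integrable_def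
      by (intro nn_integral_eq_integral[symmetric]) (auto simp: pos)
    also have "\<dots> = (\<integral>\<^sup>+x\<in>{a<..<b}. ennreal (g x) \<partial>lborel)"
    proof (rule nn_integral_cong_AE, use AE_lborel_singleton[of b] in eventually_elim)
      case (elim x)
      then show ?case by (auto simp: indicator_def)
    qed
    finally show ?thesis .
  qed
  have "ext_diff (ereal (u (\<gamma> 0))) (ereal (u (\<gamma> l))) = ennreal \<bar>u (\<gamma> 0) - u (\<gamma> l)\<bar>"
    by (simp add: ext_diff_def)
  also have "\<dots> = (\<integral>\<^sup>+x\<in>{min (\<gamma> 0) (\<gamma> l)<..<max (\<gamma> 0) (\<gamma> l)}. ennreal (g x) \<partial>lborel)"
    using diff[of "\<gamma> 0" "\<gamma> l"] diff[of "\<gamma> l" "\<gamma> 0"]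
    by (cases "\<gamma> 0 \<le> \<gamma> l") (auto simp: abs_minus_commute min_def max_def)
  also have "\<dots> \<le> (\<integral>\<^sup>+t\<in>{0..l}. ennreal (g (\<gamma> t)) \<partial>lborel)"
    by (rule nn_integral_along_curve_ge[OF arc]) simp
  finally show "ext_diff (ereal (LINT t:{..\<gamma> 0}|lborel. g t)) (ereal (LINT t:{..\<gamma> l}|lborel. g t))
      \<le> (\<integral>\<^sup>+t\<in>{0..l}. ennreal (g (\<gamma> t)) \<partial>lborel)"
    by (simp add: u_def)
qed

section \<open>Powers, balls and weights\<close>

lemma enn_powr_ennreal [simp]:
  "0 < a \<Longrightarrow> 0 \<le> x \<Longrightarrow> enn_powr (ennreal x) a = ennreal (x powr a)"
  by (auto simp: enn_powr_def)

lemma enn_powr_0 [simp]: "0 < a \<Longrightarrow> enn_powr 0 a = 0"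
  and enn_powr_top [simp]: "0 < a \<Longrightarrow> enn_powr \<infinity> a = \<infinity>" "0 < a \<Longrightarrow> enn_powr top a = top"
  by (auto simp: enn_powr_def)

lemma enn_powr_1 [simp]: "enn_powr 1 a = 1"
  by (auto simp: enn_powr_def)

lemma borel_measurable_enn_powr [measurable]: "(\<lambda>x. enn_powr x a) \<in> borel_measurable borel"
  unfolding enn_powr_def by measurable

lemma enn_powr_ennreal_pos: "0 < x \<Longrightarrow> enn_powr (ennreal x) a = ennreal (x powr a)"
  by (simp add: enn_powr_def)

lemma enn_powr_mono: "0 < a \<Longrightarrow> x \<le> y \<Longrightarrow> enn_powr x a \<le> enn_powr y a"
  by (cases x; cases y) (auto simp: top_unique intro!: ennreal_leI powr_mono2)

lemma enn_powr_antimono: "a < 0 \<Longrightarrow> x \<le> y \<Longrightarrow> enn_powr y a \<le> enn_powr x a"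
  by (cases x; cases y) (auto simp: enn_powr_def top_unique intro!: ennreal_leI powr_mono2')

lemma line_measure_ball:
  assumes "line_measure M" "0 < r"
  shows "ball x r \<in> sets M" "0 < emeasure M (ball x r)" "emeasure M (ball x r) < \<infinity>"
  using assms by (auto simp: line_measure_def)

lemma line_measure_ball_ennreal:
  assumes "line_measure M" "0 < r"
  obtains m where "0 < m" "emeasure M (ball x r) = ennreal m"
proof -
  have "0 < emeasure M (ball x r)" "emeasure M (ball x r) < top"
    using line_measure_ball[OF assms] by simp_all
  then show ?thesis
    using that[of "enn2real (emeasure M (ball x r))"] by (simp add: enn2real_positive_iff)
qed

lemma line_measure_measurable:
  assumes "line_measure M" "f \<in> borel \<rightarrow>\<^sub>M N"
  shows "f \<in> M \<rightarrow>\<^sub>M N"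
proof -
  obtain N' where N': "sets N' = sets borel" "M = completion N'"
    using assms(1) unfolding line_measure_def by blast
  have "f \<in> N' \<rightarrow>\<^sub>M N"
    unfolding measurable_cong_sets[OF N'(1) refl] by (rule assms(2))
  then show ?thesis unfolding N'(2) by (rule measurable_completion)
qed

lemma emeasure_lborel_ball: "0 \<le> r \<Longrightarrow> emeasure lborel (ball (x::real) r) = ennreal (2 * r)"
  by (simp add: ball_eq_greaterThanLessThan)

section \<open>Integrals against a measure with a weight\<close>

lemma nn_integral_has_weight:
  assumes "has_weight M w" "weight w" and f: "f \<in> borel_measurable borel"
  shows "nn_integral M f = (\<integral>\<^sup>+x. w x * f x \<partial>lebesgue)"
  using assms
  by (simp add: has_weight_def weight_def nn_integral_completion nn_integral_density measurable_completion)

lemma set_nn_integral_has_weight: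
  assumes "has_weight M w" "weight w" and f: "f \<in> borel_measurable borel" and A: "A \<in> sets borel"
  shows "(\<integral>\<^sup>+x\<in>A. f x \<partial>M) = (\<integral>\<^sup>+x\<in>A. w x * f x \<partial>lebesgue)"
proof -
  note [measurable] = f A
  show ?thesis by (subst nn_integral_has_weight[OF assms(1,2)]) (simp_all add: mult.assoc)
qed

lemma emeasure_has_weight:
  assumes "has_weight M w" "weight w" and A: "A \<in> sets borel"
  shows "emeasure M A = (\<integral>\<^sup>+x\<in>A. w x \<partial>lebesgue)"
proof -
  have "A \<in> sets lebesgue" using A by auto
  then show ?thesis
    using assms by (simp add: has_weight_def weight_def emeasure_density)
qed

section \<open>From Muckenhoupt weights to the Poincare inequality\<close>

text \<open>All values of \<open>u\<close> on \<open>B\<close> lie within \<open>D\<close> of each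
  other, so each lies within \<open>D\<close> of their mean.\<close>

lemma mean_oscillation_le:
  assumes B: "B \<in> sets M" "0 < emeasure M B" "emeasure M B < \<infinity>"
    and u: "integrable_ext M B u"
    and osc: "\<And>y z. y \<in> B \<Longrightarrow> z \<in> B \<Longrightarrow> ext_diff (u y) (u z) \<le> ennreal D" and D: "0 \<le> D"
  shows "(\<integral>\<^sup>+y\<in>B. ext_diff (u y) (ereal (mean_value M B u)) \<partial>M) / emeasure M B \<le> ennreal D"
proof -
  define v where "v y = real_of_ereal (u y)" for y
  \<comment> \<open>Both points are taken equal: \<open>ext_diff\<close> of an infinite value with
    itself is infinite, which the real bound \<open>D\<close> excludes.\<close>
  have fin: "\<bar>u y\<bar> \<noteq> \<infinity>" if "y \<in> B" for y
    using osc[OF that that] by (auto simp: ext_diff_def top_unique split: if_splits)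
  have vosc: "\<bar>v y - v z\<bar> \<le> D" if "y \<in> B" "z \<in> B" for y z
    using osc[OF that] fin[OF that(1)] fin[OF that(2)] D by (auto simp: ext_diff_def v_def ennreal_le_iff)
  obtain y0 where y0: "y0 \<in> B" using B by (metis emeasure_empty ex_in_conv less_irrefl)
  have Bm: "0 < measure M B"
    using B by (simp add: measure_def enn2real_positive_iff)
  have meas: "(\<lambda>x. indicator B x *\<^sub>R v x) \<in> borel_measurable M"
  proof -
    have [measurable]: "u \<in> borel_measurable (restrict_space M B)"
      using u by (simp add: integrable_ext_def)
    have "v \<in> borel_measurable (restrict_space M B)" unfolding v_def by measurable
    then show ?thesis
      using B by (subst (asm) borel_measurable_restrict_space_iff) (auto)
  qed
  have int: "set_integrable M B v"
    unfolding set_integrable_def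
  proof (rule Bochner_Integration.integrable_bound)
    show "integrable M (\<lambda>x. indicator B x *\<^sub>R (\<bar>v y0\<bar> + D))"
      using B by (intro integrable_scaleR_left integrable_real_indicator) auto
    show "AE x in M. norm (indicator B x *\<^sub>R v x) \<le> norm (indicator B x *\<^sub>R (\<bar>v y0\<bar> + D))"
    proof (intro AE_I2)
      fix x
      show "norm (indicator B x *\<^sub>R v x) \<le> norm (indicator B x *\<^sub>R (\<bar>v y0\<bar> + D))"
        using vosc[of x y0] y0 D by (auto simp: indicator_def)
    qed
  qed (rule meas)
  have const: "set_integrable M B (\<lambda>x. c)" "(LINT x:B|M. c) = c * measure M B" for c :: real
    using B by (simp_all add: set_integrable_def set_lebesgue_integral_def less_top[symmetric])
  have mean: "\<bar>v y - mean_value M B u\<bar> \<le> D" if y: "y \<in> B" for y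
  proof -
    have "(LINT x:B|M. v x) \<le> (LINT x:B|M. v y + D)"
      using vosc[OF y] by (intro set_integral_mono int const) (auto simp: abs_le_iff diff_le_eq add.commute)
    moreover have "(LINT x:B|M. v y - D) \<le> (LINT x:B|M. v x)"
      using vosc[OF y] by (intro set_integral_mono int const) (auto simp: abs_le_iff diff_le_eq add.commute)
    ultimately have "(LINT x:B|M. v x) \<le> (v y + D) * measure M B"
      "(v y - D) * measure M B \<le> (LINT x:B|M. v x)" by (simp_all only: const)
    then have "mean_value M B u \<le> v y + D" "v y - D \<le> mean_value M B u"
      using Bm by (simp_all add: mean_value_def v_def divide_le_eq le_divide_eq)
    then show ?thesis by (simp add: abs_le_iff)
  qed
  have "(\<integral>\<^sup>+y\<in>B. ext_diff (u y) (ereal (mean_value M B u)) \<partial>M) \<le> (\<integral>\<^sup>+y. ennreal D * indicator B y \<partial>M)"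
    using mean fin by (intro nn_integral_mono) (auto simp: indicator_def ext_diff_def v_def intro!: ennreal_leI)
  also have "\<dots> = ennreal D * emeasure M B"
    using B by (simp add: nn_integral_cmult_indicator)
  finally show ?thesis using B
    by (metis divide_le_posI_ennreal mult.commute)
qed

text \<open>The bound through which the conditions are compared. Since \<open>ball x r\<close> has
  length \<open>2 * r\<close>, dividing by this length gives the averaged form with constant
  \<open>K / 2\<close>.\<close>

definition mean_inequality :: "real \<Rightarrow> real \<Rightarrow> real measure \<Rightarrow> real \<Rightarrow> real \<Rightarrow> bool" where
  "mean_inequality K p M x r \<longleftrightarrow>
     (\<forall>g \<in> borel_measurable borel.
        (\<integral>\<^sup>+y\<in>ball x r. g y \<partial>lborel) \<le> ennreal (K * r) *
          enn_powr ((\<integral>\<^sup>+y\<in>ball x r. enn_powr (g y) p \<partial>M) / emeasure M (ball x r)) (1 / p))"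

lemma mean_inequalityD:
  assumes "mean_inequality K p M x r" "g \<in> borel_measurable borel"
  shows "(\<integral>\<^sup>+y\<in>ball x r. g y \<partial>lborel) \<le> ennreal (K * r) *
    enn_powr ((\<integral>\<^sup>+y\<in>ball x r. enn_powr (g y) p \<partial>M) / emeasure M (ball x r)) (1 / p)"
  using assms unfolding mean_inequality_def by (rule bspec)

text \<open>The oscillation of \<open>u\<close> over a ball is at most the Lebesgue integral of its
  upper gradient, which \<open>mean_inequality\<close> bounds by the right-hand side of the Poincare
  inequality with dilation factor 1.\<close>

lemma poincare_with_mean_inequality:
  fixes M :: "real measure"
  assumes p: "1 \<le> p" and M: "line_measure M"
    and mi: "\<And>x r. 0 < r \<Longrightarrow> ball x r \<subseteq> B0 \<Longrightarrow> mean_inequality K p M x r"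
  shows "poincare_with K 1 p M B0"
  unfolding poincare_with_def
proof (intro allI impI, elim conjE)
  fix x r u g
  assume r: "0 < r" and B0: "ball x r \<subseteq> B0"
    and u: "integrable_ext M (ball x (1 * r)) u"
    and ug: "upper_gradient (ball x (1 * r)) u g"
  let ?B = "ball x r"
  define D where "D = (\<integral>\<^sup>+t\<in>?B. g t \<partial>lborel)"
  have osc: "ext_diff (u y) (u z) \<le> D" if "y \<in> ?B" "z \<in> ?B" "y \<noteq> z" for y z
    unfolding D_def using ug that by (intro ext_diff_upper_gradient_le) auto
  let ?g = "\<lambda>t. g t * indicator ?B t"
  have g: "?g \<in> borel_measurable borel"
    using ug by (auto simp: upper_gradient_def borel_measurable_restrict_space_iff_ennreal)
  have "D = (\<integral>\<^sup>+t\<in>?B. ?g t \<partial>lborel)"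
    unfolding D_def by (intro nn_integral_cong) (auto simp: indicator_def)
  also have "\<dots> \<le> ennreal (K * r) *
      enn_powr ((\<integral>\<^sup>+y\<in>?B. enn_powr (?g y) p \<partial>M) / emeasure M ?B) (1 / p)"
    by (rule mean_inequalityD[OF mi[OF r B0] g])
  also have "(\<integral>\<^sup>+y\<in>?B. enn_powr (?g y) p \<partial>M) = (\<integral>\<^sup>+y\<in>?B. enn_powr (g y) p \<partial>M)"
    by (intro nn_integral_cong) (auto simp: indicator_def)
  finally have D: "D \<le> ennreal (K * r) *
      enn_powr ((\<integral>\<^sup>+y\<in>?B. enn_powr (g y) p \<partial>M) / emeasure M ?B) (1 / p)" .
  have "(\<integral>\<^sup>+y\<in>?B. ext_diff (u y) (ereal (mean_value M ?B u)) \<partial>M) / emeasure M ?B \<le> D"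
  proof (cases "D = \<infinity>")
    case False
    have "ext_diff (u y) (u z) \<le> ennreal (enn2real D)" if yz: "y \<in> ?B" "z \<in> ?B" for y z
    proof (cases "y = z")
      case True
      \<comment> \<open>For equal points only the finiteness of \<open>u y\<close> is at issue;
        comparing with another point \<open>z'\<close> of the ball shows it, because
        \<open>D\<close> is finite.\<close>
      define z' where "z' = (if y = x then x + r/2 else x)"
      have "ext_diff (u y) (u z') \<le> D"
        using r yz by (intro osc) (auto simp: z'_def dist_real_def)
      then have "\<bar>u y\<bar> \<noteq> \<infinity>"
        using False by (auto simp: ext_diff_def top_unique split: if_splits)
      then show ?thesis using True by (simp add: ext_diff_def)
    qed (use osc[of y z] yz False in \<open>simp add: less_top\<close>)
    then have "(\<integral>\<^sup>+y\<in>?B. ext_diff (u y) (ereal (mean_value M ?B u)) \<partial>M) / emeasure M ?B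
        \<le> ennreal (enn2real D)"
      by (intro mean_oscillation_le line_measure_ball[OF M r]) (use u in auto)
    then show ?thesis using False by (simp add: less_top)
  qed simp
  then show "(\<integral>\<^sup>+y\<in>?B. ext_diff (u y) (ereal (mean_value M ?B u)) \<partial>M) / emeasure M ?B
      \<le> ennreal (K * r) * enn_powr ((\<integral>\<^sup>+y\<in>ball x (1 * r). enn_powr (g y) p \<partial>M)
            / emeasure M (ball x (1 * r))) (1 / p)"
    using D by (simp add: order_trans)
qed

text \<open>The test function is the indicator of \<open>ball x r\<close> inside
  \<open>ball x (2 * r)\<close>. The radius \<open>R / 4\<close> keeps the doubled ball within
  \<open>ball x0 R\<close>.\<close>

lemma doubling_with_mean_inequality:
  fixes M :: "real measure"
  assumes p: "1 \<le> p" and M: "line_measure M" and K: "0 < K"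
    and mi: "\<And>x r. 0 < r \<Longrightarrow> ball x r \<subseteq> ball x0 R \<Longrightarrow> mean_inequality K p M x r"
  shows "doubling_with (K powr p) M (ball x0 (R / 4))"
  unfolding doubling_with_def
proof (intro allI impI, elim conjE)
  fix x r :: real assume r: "0 < r" and sub: "ball x r \<subseteq> ball x0 (R/4)"
  obtain m1 where m1: "emeasure M (ball x r) = ennreal m1" "0 < m1"
    using line_measure_ball_ennreal[OF M r] by blast
  obtain m2 where m2: "emeasure M (ball x (2*r)) = ennreal m2" "0 < m2"
    using line_measure_ball_ennreal[OF M, of "2*r"] r by auto
  have "ball x (2*r) \<subseteq> ball x0 R"
    using sub r by (auto simp: ball_eq_greaterThanLessThan greaterThanLessThan_subseteq_greaterThanLessThan)
  then have "(\<integral>\<^sup>+y\<in>ball x (2*r). indicator (ball x r) y \<partial>lborel) \<le> ennreal (K * (2*r)) *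
      enn_powr ((\<integral>\<^sup>+y\<in>ball x (2*r). enn_powr (indicator (ball x r) y) p \<partial>M)
        / emeasure M (ball x (2*r))) (1 / p)"
    using r by (intro mean_inequalityD mi borel_measurable_indicator) auto
  also have "(\<integral>\<^sup>+y\<in>ball x (2*r). indicator (ball x r) y \<partial>lborel) = (\<integral>\<^sup>+y. indicator (ball x r) y \<partial>lborel)"
    using r by (intro nn_integral_cong) (auto simp: indicator_def)
  also have "\<dots> = ennreal (2 * r)"
    using r by (subst nn_integral_indicator) (auto simp: ball_eq_greaterThanLessThan)
  also have "(\<integral>\<^sup>+y\<in>ball x (2*r). enn_powr (indicator (ball x r) y) p \<partial>M) = (\<integral>\<^sup>+y. indicator (ball x r) y \<partial>M)"
    using r p by (intro nn_integral_cong) (auto simp: indicator_def)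
  also have "\<dots> = ennreal m1" using line_measure_ball[OF M r] m1 by simp
  also have "ennreal (K * (2*r)) * enn_powr (ennreal m1 / emeasure M (ball x (2*r))) (1 / p)
      = ennreal (K * (2*r) * (m1/m2) powr (1/p))"
    using m1 m2 p K r by (simp add: divide_ennreal ennreal_mult)
  finally have "2 * r \<le> K * (2*r) * (m1/m2) powr (1/p)"
    using K r by (subst (asm) ennreal_le_iff) auto
  then have "1 \<le> K * (m1/m2) powr (1/p)" using r by (simp add: field_simps)
  then have "1 \<le> (K * (m1/m2) powr (1/p)) powr p" using p by (intro ge_one_powr_ge_zero) auto
  also have "\<dots> = K powr p * (m1 / m2)" using K m1 m2 p by (simp add: powr_mult powr_powr)
  finally have "m2 \<le> K powr p * m1" using m2 by (simp add: field_simps)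
  then show "emeasure M (ball x (2 * r)) \<le> ennreal (K powr p) * emeasure M (ball x r)"
    using m1 m2 by (simp add: ennreal_mult'[symmetric] ennreal_le_iff)
qed

text \<open>Integrating this and choosing \<open>s\<close> gives the Hoelder inequality up to a factor 2, with no separate
  treatment of vanishing or infinite integrals of the dual weight.\<close>

lemma enn_powr_le_weighted:
  fixes g w :: ennreal
  assumes p: "1 < p" and s: "0 < s"
  shows "g \<le> ennreal s * enn_powr w (1 / (1 - p)) + ennreal (s powr (1 - p)) * (w * enn_powr g p)"
proof (cases "g = 0")
  case False
  have sp: "0 < s powr (1 - p)" using s by simp
  have q: "1 / (1 - p) < 0" using p by simp
  \<comment> \<open>The exponent \<open>1 / (1 - p)\<close> is negative: at \<open>w = 0\<close> the
    first term on the right is infinite, and in the next two cases the second term is.\<close>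
  consider "w = 0" | "w = \<infinity>" | "g = \<infinity>" "w \<noteq> 0" | a b where "g = ennreal a" "w = ennreal b" "0 < a" "0 < b"
    using False by (cases g; cases w) (auto simp: less_le)
  then show ?thesis
  proof cases
    case 1
    then show ?thesis using q p s by (simp add: enn_powr_def ennreal_mult_top)
  next
    case 2
    have "enn_powr g p \<noteq> 0" using False p by (cases g) (auto simp: enn_powr_def)
    then show ?thesis using 2 sp by (simp add: ennreal_top_mult ennreal_mult_top)
  next
    case 3
    then show ?thesis using p sp by (simp add: ennreal_mult_top)
  next
    case 4
    \<comment> \<open>If \<open>a\<close> exceeds the first term, raising to the negative power
      \<open>1 - p\<close> gives \<open>a powr (1 - p) \<le> s powr (1 - p) * b\<close>;
      multiplication by \<open>a powr p\<close> shows that \<open>a\<close> is at most the second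
      term.\<close>
    have "a \<le> s * b powr (1/(1-p)) + s powr (1-p) * (b * a powr p)"
    proof (cases "a \<le> s * b powr (1/(1-p))")
      case True
      then show ?thesis using 4 by (simp add: add_increasing2)
    next
      case False
      have "a powr (1-p) \<le> (s * b powr (1/(1-p))) powr (1-p)"
        using False 4 s p by (intro powr_mono2') auto
      also have "\<dots> = s powr (1-p) * b" using s p 4 by (simp add: powr_mult powr_powr)
      finally have "a powr (1-p) * a powr p \<le> s powr (1-p) * b * a powr p"
        by (intro mult_right_mono) auto
      moreover have "a powr (1-p) * a powr p = a" using 4 by (simp add: powr_add[symmetric])
      moreover have "0 \<le> s * b powr (1/(1-p))" using s by simp
      ultimately show ?thesis by (simp add: mult.assoc)
    qed
    then have "ennreal a \<le> ennreal (s * b powr (1/(1-p)) + s powr (1-p) * (b * a powr p))"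
      by (rule ennreal_leI)
    also have "\<dots> = ennreal s * ennreal (b powr (1/(1-p))) + ennreal (s powr (1-p)) * (ennreal b * ennreal (a powr p))"
      using s 4 by (simp add: ennreal_mult)
    finally show ?thesis
      using 4 p by (simp add: enn_powr_def)
  qed
next
  case True
  show ?thesis unfolding True by (rule zero_le)
qed

text \<open>The two terms balance at \<open>s = (a / T) powr (1 / p)\<close>, where \<open>a\<close>
  is the value of \<open>A\<close>. If \<open>A = 0\<close>, letting \<open>s\<close> tend to 0
  gives \<open>D = 0\<close>; if \<open>A\<close> is infinite, so is the right-hand side.\<close>

lemma optimize_scale:
  fixes T :: real
  assumes p: "1 < p" and T: "0 < T"
    and D: "\<And>s. 0 < s \<Longrightarrow> D \<le> ennreal (s * T) + ennreal (s powr (1 - p)) * A"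
  shows "D \<le> ennreal (2 * T powr (1 - 1 / p)) * enn_powr A (1 / p)"
proof (cases A)
  case top
  then show ?thesis using p T by (simp add: ennreal_mult_top)
next
  case (real a)
  show ?thesis
  proof (cases "a = 0")
    case True
    have "D \<le> 0"
    proof (rule ennreal_le_epsilon)
      fix e :: real assume "0 < e"
      then show "D \<le> 0 + ennreal e" using D[of "e / T"] T True real by simp
    qed
    then show ?thesis by simp
  next
    case False
    then have a: "0 < a" using real by simp
    define s where "s = (a / T) powr (1/p)"
    have s: "0 < s" using a T by (simp add: s_def)
    have 1: "s * T = T powr (1 - 1/p) * a powr (1/p)"
      using a T by (simp add: s_def powr_divide powr_diff)
    have b: "0 < a / T" using a T by simp
    have e: "1 / p * (1 - p) + 1 = 1 / p" using p by (simp add: field_simps)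
    have "s powr (1 - p) * (a / T) = (a / T) powr (1 / p * (1 - p)) * (a / T) powr 1"
      using a T unfolding s_def powr_powr by simp
    also have "\<dots> = s" unfolding powr_add[symmetric] e s_def ..
    finally have 2: "s powr (1 - p) * a = s * T" using T by (simp add: field_simps)
    have "D \<le> ennreal (s * T) + ennreal (s powr (1 - p)) * A" by (rule D[OF s])
    also have "\<dots> = ennreal (s * T + s powr (1 - p) * a)"
      using real s T by (simp add: ennreal_mult')
    also have "\<dots> = ennreal (2 * T powr (1 - 1/p)) * enn_powr A (1/p)"
      using real p T unfolding 2 1 by (simp add: ennreal_mult'[symmetric])
    finally show ?thesis .
  qed
qed

text \<open>For \<open>p = 1\<close> the weight is almost everywhere at least a fixed fraction of
  its mean. For \<open>p > 1\<close> the Muckenhoupt condition bounds the dual integral,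
  \<open>enn_powr_le_weighted\<close> is integrated with that bound, and
  \<open>optimize_scale\<close> chooses \<open>s\<close>.\<close>

lemma mean_inequality_Ap:
  fixes M :: "real measure"
  assumes p: "1 \<le> p" and M: "line_measure M" and hw: "has_weight M w" and w: "weight w"
    and C: "0 < C" and Ap: "Ap_with C p w B0" and r: "0 < r" "ball x r \<subseteq> B0"
  shows "mean_inequality (4 * C powr (1 / p)) p M x r"
  unfolding mean_inequality_def
proof
  fix g :: "real \<Rightarrow> ennreal" assume g[measurable]: "g \<in> borel_measurable borel"
  let ?B = "ball x r"
  have [measurable]: "w \<in> borel_measurable lebesgue" using w by (simp add: weight_def)
  have [measurable]: "g \<in> borel_measurable lebesgue" using g by (intro measurable_completion) simp
  have [measurable]: "(\<lambda>y. enn_powr (g y) p) \<in> borel_measurable lebesgue" "(\<lambda>y. enn_powr (w y) a) \<in> borel_measurable lebesgue" for a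
    by (rule measurable_compose[OF _ borel_measurable_enn_powr]; fact)+
  have [measurable]: "?B \<in> sets lebesgue" by auto
  obtain m where m: "emeasure M ?B = ennreal m" "0 < m"
    using line_measure_ball_ennreal[OF M r(1)] by blast
  have W: "(\<integral>\<^sup>+y\<in>?B. w y \<partial>lebesgue) = ennreal m"
    using emeasure_has_weight[OF hw w, of ?B] m by simp
  define A where "A = (\<integral>\<^sup>+y\<in>?B. enn_powr (g y) p \<partial>M)"
  have A: "A = (\<integral>\<^sup>+y\<in>?B. w y * enn_powr (g y) p \<partial>lebesgue)"
    unfolding A_def by (rule set_nn_integral_has_weight[OF hw w]) auto
  have avg: "(\<integral>\<^sup>+y\<in>?B. w y \<partial>lebesgue) / emeasure lebesgue ?B = ennreal (m / (2*r))"
    using r m by (simp add: W emeasure_lborel_ball divide_ennreal)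
  have Ap': "ennreal (m / (2*r)) < ennreal C * (if p = 1 then ess_inf_on lebesgue ?B w
      else enn_powr ((\<integral>\<^sup>+y\<in>?B. enn_powr (w y) (1 / (1 - p)) \<partial>lebesgue) / emeasure lebesgue ?B) (1 - p))"
    using Ap r unfolding Ap_with_def avg[symmetric] by blast
  have leb: "(\<integral>\<^sup>+y\<in>?B. g y \<partial>lborel) = (\<integral>\<^sup>+y\<in>?B. g y \<partial>lebesgue)"
    by (simp add: nn_integral_completion)
  \<comment> \<open>Passes from the integral \<open>A\<close> to its average over the ball, also for
    infinite \<open>A\<close>.\<close>
  have scale: "ennreal c * enn_powr A (1/p) = ennreal (c * m powr (1/p)) * enn_powr (A / ennreal m) (1/p)"
    if "0 \<le> c" for c
  proof (cases A)
    case (real a)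
    then show ?thesis
      using that m p by (simp add: divide_ennreal powr_divide ennreal_mult'[symmetric])
  next
    case top
    then show ?thesis
      using that m p by (simp add: ennreal_top_divide ennreal_mult_top ennreal_mult_eq_top_iff)
  qed
  show "(\<integral>\<^sup>+y\<in>?B. g y \<partial>lborel) \<le> ennreal (4 * C powr (1 / p) * r) *
     enn_powr ((\<integral>\<^sup>+y\<in>?B. enn_powr (g y) p \<partial>M) / emeasure M ?B) (1 / p)"
    unfolding A_def[symmetric] m(1) leb
  proof (cases "p = 1")
    case True
    \<comment> \<open>\<open>c0\<close> is the mean of the weight divided by \<open>C\<close>. As
      the Muckenhoupt inequality is strict, \<open>c0\<close> lies below the essential infimum, so
      some almost everywhere lower bound exceeds it.\<close>
    define c0 where "c0 = m / (2 * r * C)"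
    have c0: "0 < c0" using m r C by (simp add: c0_def)
    have "ennreal C * ennreal c0 = ennreal (m / (2*r))"
      using C c0 by (subst ennreal_mult[symmetric]) (auto simp: c0_def)
    then have "ennreal C * ennreal c0 < ennreal C * ess_inf_on lebesgue ?B w"
      using Ap' True by simp
    then have "ennreal c0 < ess_inf_on lebesgue ?B w"
      by (meson mult_left_mono not_le zero_le)
    then obtain c where c: "ennreal c0 < c" "AE y in lebesgue. y \<in> ?B \<longrightarrow> c \<le> w y"
      unfolding ess_inf_on_def less_Sup_iff by auto
    have "ennreal c0 * (\<integral>\<^sup>+y\<in>?B. g y \<partial>lebesgue) = (\<integral>\<^sup>+y\<in>?B. ennreal c0 * g y \<partial>lebesgue)"
      by (subst nn_integral_cmult[symmetric]) (auto simp: mult.assoc)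
    also have "\<dots> \<le> (\<integral>\<^sup>+y\<in>?B. w y * g y \<partial>lebesgue)"
    proof (intro nn_integral_mono_AE, use c(2) in eventually_elim)
      case (elim y)
      have "ennreal c0 \<le> w y" if "y \<in> ?B" using elim that c(1) by (meson less_imp_le order_trans)
      then show ?case by (auto simp: indicator_def intro!: mult_right_mono)
    qed
    also have "\<dots> = A" unfolding A using True
      by (intro nn_integral_cong) (auto simp: enn_powr_def ennreal_enn2real_if)
    finally have *: "ennreal c0 * (\<integral>\<^sup>+y\<in>?B. g y \<partial>lebesgue) \<le> A" .
    have "(\<integral>\<^sup>+y\<in>?B. g y \<partial>lebesgue) = ennreal (1/c0) * (ennreal c0 * (\<integral>\<^sup>+y\<in>?B. g y \<partial>lebesgue))"
    proof -
      have "ennreal (1/c0) * ennreal c0 = 1" using c0 by (subst ennreal_mult[symmetric]) auto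
      then show ?thesis by (simp add: mult.assoc[symmetric])
    qed
    also have "\<dots> \<le> ennreal (1/c0) * A" by (intro mult_left_mono *) simp
    also have "\<dots> = ennreal (1/c0) * enn_powr A (1/p)" using True by (simp add: enn_powr_def ennreal_enn2real_if)
    also have "\<dots> = ennreal (1/c0 * m powr (1/p)) * enn_powr (A / ennreal m) (1/p)"
      using c0 by (intro scale) auto
    also have "\<dots> \<le> ennreal (4 * C powr (1 / p) * r) * enn_powr (A / ennreal m) (1/p)"
      using True m r C by (intro mult_right_mono ennreal_leI) (auto simp: c0_def)
    finally show "(\<integral>\<^sup>+y\<in>?B. g y \<partial>lebesgue) \<le> ennreal (4 * C powr (1 / p) * r) * enn_powr (A / ennreal m) (1/p)" .
  next
    case False
    then have p1: "1 < p" using p by simp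
    define S where "S = (\<integral>\<^sup>+y\<in>?B. enn_powr (w y) (1 / (1 - p)) \<partial>lebesgue)"
    \<comment> \<open>The Muckenhoupt inequality
      \<open>m / (2 * r) < C * (S / (2 * r)) powr (1 - p)\<close>, solved for \<open>S\<close>,
      gives this upper bound. An infinite \<open>S\<close> would make the right-hand side
      vanish.\<close>
    define T where "T = 2 * r * (2 * r * C / m) powr (1 / (p - 1))"
    have T: "0 < T" using r C m by (simp add: T_def)
    have ApS: "ennreal (m / (2*r)) < ennreal C * enn_powr (S / ennreal (2*r)) (1 - p)"
      using Ap' False r by (simp add: S_def emeasure_lborel_ball)
    have ST: "S \<le> ennreal T"
    proof (cases S)
      case top
      then show ?thesis using ApS p1 by (simp add: enn_powr_def ennreal_top_divide)
    next
      case (real a)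
      show ?thesis
      proof (cases "a = 0")
        case False
        then have a: "0 < a" using real by simp
        have "ennreal (m / (2*r)) < ennreal (C * (a / (2*r)) powr (1 - p))"
        proof -
          have "S / ennreal (2*r) = ennreal (a / (2*r))" using real r by (simp only: divide_ennreal)
          then have "ennreal (m / (2*r)) < ennreal C * ennreal ((a / (2*r)) powr (1 - p))"
            using ApS a r by (simp only: enn_powr_ennreal_pos[OF divide_pos_pos])
          then show ?thesis using C by (simp only: ennreal_mult'[OF less_imp_le])
        qed
        then have "m / (2*r) < C * (a / (2*r)) powr (1 - p)"
          using m r by (subst (asm) ennreal_less_iff) auto
        then have "m / (2*r) * (a / (2*r)) powr (p - 1) < C * (a / (2*r)) powr (1 - p) * (a / (2*r)) powr (p - 1)"
          using a r by (intro mult_strict_right_mono) auto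
        also have "\<dots> = C * ((a / (2*r)) powr (1 - p) * (a / (2*r)) powr (p - 1))" by simp
        also have "(a / (2*r)) powr (1 - p) * (a / (2*r)) powr (p - 1) = 1"
          using a r by (simp add: powr_add[symmetric])
        finally have "(a / (2*r)) powr (p - 1) \<le> 2 * r * C / m"
          using m r by (simp add: field_simps)
        then have "((a / (2*r)) powr (p - 1)) powr (1 / (p - 1)) \<le> (2 * r * C / m) powr (1 / (p - 1))"
          using p1 by (intro powr_mono2) auto
        then have "a / (2*r) \<le> (2 * r * C / m) powr (1 / (p - 1))"
          using p1 a r by (simp add: powr_powr)
        then show ?thesis using real r by (auto simp: T_def field_simps intro!: ennreal_leI)
      qed (use real in simp)
    qed
    have D: "(\<integral>\<^sup>+y\<in>?B. g y \<partial>lebesgue) \<le> ennreal (s * T) + ennreal (s powr (1 - p)) * A" if s: "0 < s" for s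
    proof -
      have "(\<integral>\<^sup>+y\<in>?B. g y \<partial>lebesgue) \<le> (\<integral>\<^sup>+y. ennreal s * (enn_powr (w y) (1 / (1 - p)) * indicator ?B y)
           + ennreal (s powr (1 - p)) * (w y * enn_powr (g y) p * indicator ?B y) \<partial>lebesgue)"
        using enn_powr_le_weighted[OF p1 s] by (intro nn_integral_mono) (auto simp: indicator_def)
      also have "\<dots> = ennreal s * S + ennreal (s powr (1 - p)) * A"
        unfolding S_def A by (subst nn_integral_add) (auto simp: nn_integral_cmult)
      also have "\<dots> \<le> ennreal s * ennreal T + ennreal (s powr (1 - p)) * A"
        by (intro add_mono mult_left_mono ST) auto
      finally show ?thesis using s by (simp add: ennreal_mult')
    qed
    have "(\<integral>\<^sup>+y\<in>?B. g y \<partial>lebesgue) \<le> ennreal (2 * T powr (1 - 1 / p)) * enn_powr A (1 / p)"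
      by (rule optimize_scale[OF p1 T D])
    also have "\<dots> = ennreal (2 * T powr (1 - 1 / p) * m powr (1/p)) * enn_powr (A / ennreal m) (1/p)"
      by (intro scale) auto
    \<comment> \<open>The powers of \<open>m\<close> cancel, so the constant depends only on
      \<open>C\<close> and \<open>p\<close>.\<close>
    also have "2 * T powr (1 - 1 / p) * m powr (1/p) = 4 * C powr (1 / p) * r"
    proof -
      have "T powr (1 - 1/p) = (2 * r) powr (1 - 1/p) * (2 * r * C / m) powr (1/p)"
      proof -
        have "1 / (p - 1) * (1 - 1/p) = 1/p" using p1 by (simp add: field_simps)
        then show ?thesis unfolding T_def using r C m by (simp add: powr_mult powr_powr)
      qed
      also have "\<dots> = ((2 * r) powr (1 - 1/p) * (2 * r) powr (1/p)) * C powr (1/p) / m powr (1/p)"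
        using r C m by (simp add: powr_mult powr_divide)
      also have "(2 * r) powr (1 - 1/p) * (2 * r) powr (1/p) = 2 * r"
        using r by (simp add: powr_add[symmetric])
      finally show ?thesis using m by simp
    qed
    finally show "(\<integral>\<^sup>+y\<in>?B. g y \<partial>lebesgue) \<le> ennreal (4 * C powr (1 / p) * r) * enn_powr (A / ennreal m) (1/p)" .
  qed
qed

section \<open>From the Poincare inequality to Muckenhoupt weights\<close>

lemma poincare_withD:
  assumes "poincare_with C L p M B0" "0 < r" "ball x r \<subseteq> B0"
    and "integrable_ext M (ball x (L * r)) u" "upper_gradient (ball x (L * r)) u g"
  shows "(\<integral>\<^sup>+y\<in>ball x r. ext_diff (u y) (ereal (mean_value M (ball x r) u)) \<partial>M) / emeasure M (ball x r)
    \<le> ennreal (C * r) * enn_powr ((\<integral>\<^sup>+y\<in>ball x (L * r). enn_powr (g y) p \<partial>M)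
         / emeasure M (ball x (L * r))) (1 / p)"
  using assms unfolding poincare_with_def by blast

lemma doubling_thrice:
  assumes d: "doubling_with C M B0" and C: "0 < C" and r: "0 < r" and sub: "ball y (4 * r) \<subseteq> B0"
  shows "emeasure M (ball y (8 * r)) \<le> ennreal (C ^ 3) * emeasure M (ball y r)"
proof -
  have D: "emeasure M (ball y (2 * s)) \<le> ennreal C * emeasure M (ball y s)" if "0 < s" "s \<le> 4 * r" for s
  proof -
    have "ball y s \<subseteq> B0" using that sub subset_ball[OF that(2), of y] by simp
    then show ?thesis using d that(1) unfolding doubling_with_def by simp
  qed
  have "emeasure M (ball y (8 * r)) \<le> ennreal C * emeasure M (ball y (4 * r))"
    using D[of "4 * r"] r by simp
  also have "\<dots> \<le> ennreal C * (ennreal C * emeasure M (ball y (2 * r)))"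
    using D[of "2 * r"] r by (intro mult_left_mono) auto
  also have "\<dots> \<le> ennreal C * (ennreal C * (ennreal C * emeasure M (ball y r)))"
    using D[of r] r by (intro mult_left_mono) auto
  also have "\<dots> = ennreal (C ^ 3) * emeasure M (ball y r)"
    using C by (simp only: power3_eq_cube ennreal_mult' less_imp_le mult.assoc mult_pos_pos)
  finally show ?thesis .
qed

text \<open>As \<open>g\<close> lives on the middle third of \<open>ball x (3 * r)\<close>, its
  antiderivative \<open>u\<close> is constant on the outer thirds, with values 0 and
  \<open>m\<close>. The mean of \<open>u\<close> is at distance at least \<open>m / 2\<close> from
  one of them.\<close>

lemma integral_bound_admissible:
  fixes M :: "real measure" and g :: "real \<Rightarrow> real"
  assumes p: "1 \<le> p" and M: "line_measure M"
    and d: "doubling_with C1 M (ball x0 R)" and C1: "0 < C1"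
    and P: "poincare_with C2 L p M (ball x0 R)" and C2: "0 < C2" and L: "1 \<le> L"
    and r: "0 < r" "ball x r \<subseteq> ball x0 (R / 8)"
    and g[measurable]: "g \<in> borel_measurable borel" and pos: "\<And>t. 0 \<le> g t"
    and int: "integrable lborel g" and supp: "\<And>t. t \<notin> ball x r \<Longrightarrow> g t = 0"
    and G: "(\<integral>\<^sup>+t. ennreal (g t powr p) \<partial>M) = ennreal G" "0 \<le> G"
  shows "(LINT t|lborel. g t) powr p * measure M (ball x r) \<le> (6 * C1 ^ 3 * C2 * r) powr p * G"
proof -
  define m where "m = (LINT t|lborel. g t)"
  define u where "u y = (LINT t:{..y}|lborel. g t)" for y
  have si: "set_integrable lborel A g" if "A \<in> sets borel" for A
    by (rule set_integrable_subset[of lborel UNIV g]) (use that in \<open>auto simp: set_integrable_def int\<close>)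
  have m0: "0 \<le> m" unfolding m_def by (intro integral_nonneg_AE) (auto simp: pos)
  have u_left: "u y = 0" if "y \<in> ball (x - 2 * r) r" for y
  proof -
    have "indicator {..y} t *\<^sub>R g t = 0" for t
      using supp[of t] that by (cases "t \<le> y") (auto simp: dist_real_def)
    then show ?thesis unfolding u_def set_lebesgue_integral_def by (simp only: integral_zero)
  qed
  have u_right: "u y = m" if "y \<in> ball (x + 2 * r) r" for y
  proof -
    have "indicator {..y} t *\<^sub>R g t = g t" for t
      using supp[of t] that by (cases "t \<le> y") (auto simp: dist_real_def)
    then show ?thesis unfolding u_def m_def set_lebesgue_integral_def by (simp only:)
  qed
  have u_bounds: "0 \<le> u y" "u y \<le> m" for y
  proof -
    show "0 \<le> u y" unfolding u_def set_lebesgue_integral_def by (intro integral_nonneg_AE) (auto simp: pos)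
    show "u y \<le> m" unfolding u_def m_def set_lebesgue_integral_def
      using si[of "{..y}"] by (intro integral_mono int) (auto simp: pos indicator_def set_integrable_def)
  qed
  have "mono u"
  proof (rule monoI)
    fix y z :: real assume "y \<le> z"
    then show "u y \<le> u z" unfolding u_def set_lebesgue_integral_def
      using si[of "{..y}"] si[of "{..z}"] by (intro integral_mono) (auto simp: pos indicator_def set_integrable_def)
  qed
  then have um: "u \<in> borel_measurable borel" by (rule borel_measurable_mono)
  let ?B = "ball x (3 * r)" and ?LB = "ball x (L * (3 * r))"
  have L3: "0 < L * (3 * r)" using L r by simp
  obtain b where b: "0 < b" "emeasure M ?B = ennreal b"
    using line_measure_ball_ennreal[OF M, of "3 * r"] r by auto
  obtain bL where bL: "0 < bL" "emeasure M ?LB = ennreal bL"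
    using line_measure_ball_ennreal[OF M L3] by blast
  obtain bs where bs: "0 < bs" "emeasure M (ball x r) = ennreal bs"
    using line_measure_ball_ennreal[OF M, of r] r by blast
  \<comment> \<open>These bounds leave room for \<open>ball y (4 * r)\<close> with \<open>y\<close>
    at distance \<open>2 * r\<close> from \<open>x\<close>, which reaches out to distance
    \<open>6 * r\<close> from \<open>x\<close>.\<close>
  have geom: "x0 - R / 8 \<le> x - r" "x + r \<le> x0 + R / 8"
    using r by (auto simp: ball_eq_greaterThanLessThan greaterThanLessThan_subseteq_greaterThanLessThan)
  have B_sub: "?B \<subseteq> ball x0 R"
    using geom r by (auto simp: ball_eq_greaterThanLessThan)
  \<comment> \<open>Three doublings lead from an outer third \<open>ball y r\<close> to
    \<open>ball y (8 * r)\<close>, which contains \<open>ball x (3 * r)\<close>; two would stop at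
    \<open>ball y (4 * r)\<close>, which does not.\<close>
  have side: "ennreal (b / C1 ^ 3) \<le> emeasure M (ball y r)" "ball y r \<subseteq> ?B" if y: "y = x - 2 * r \<or> y = x + 2 * r" for y
  proof -
    show "ball y r \<subseteq> ?B" using y r by (auto simp: ball_eq_greaterThanLessThan)
    obtain c where c: "0 < c" "emeasure M (ball y r) = ennreal c"
      using line_measure_ball_ennreal[OF M r(1)] by blast
    have "ball y (4 * r) \<subseteq> ball x0 R" using geom r y by (auto simp: ball_eq_greaterThanLessThan)
    then have "emeasure M (ball y (8 * r)) \<le> ennreal (C1 ^ 3) * emeasure M (ball y r)"
      by (rule doubling_thrice[OF d C1 r(1)])
    moreover have "emeasure M ?B \<le> emeasure M (ball y (8 * r))"
      using y r by (intro emeasure_mono line_measure_ball(1)[OF M]) (auto simp: ball_eq_greaterThanLessThan)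
    ultimately have "ennreal b \<le> ennreal (C1 ^ 3 * c)"
      using b c C1 by (simp add: ennreal_mult')
    then have "b \<le> C1 ^ 3 * c" using c C1 by (subst (asm) ennreal_le_iff) auto
    then show "ennreal (b / C1 ^ 3) \<le> emeasure M (ball y r)"
      unfolding c using C1 by (intro ennreal_leI) (simp add: field_simps)
  qed
  define c where "c = mean_value M ?B (\<lambda>y. ereal (u y))"
  have "\<exists>y. (y = x - 2 * r \<or> y = x + 2 * r) \<and> (\<forall>z\<in>ball y r. m / 2 \<le> \<bar>u z - c\<bar>)"
  proof (cases "m / 2 \<le> \<bar>c\<bar>")
    case True
    then show ?thesis using u_left by (intro exI[of _ "x - 2 * r"]) auto
  next
    case False
    then show ?thesis using u_right by (intro exI[of _ "x + 2 * r"]) auto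
  qed
  then obtain y where y: "y = x - 2 * r \<or> y = x + 2 * r" "\<And>z. z \<in> ball y r \<Longrightarrow> m / 2 \<le> \<bar>u z - c\<bar>"
    by blast
  have "ennreal (m / 2 * (b / C1 ^ 3)) = ennreal (m / 2) * ennreal (b / C1 ^ 3)"
    using m0 b C1 by (intro ennreal_mult) auto
  also have "\<dots> \<le> ennreal (m / 2) * emeasure M (ball y r)"
    by (intro mult_left_mono side y) simp
  also have "\<dots> = (\<integral>\<^sup>+z. ennreal (m / 2) * indicator (ball y r) z \<partial>M)"
    using line_measure_ball[OF M r(1)] by (simp add: nn_integral_cmult_indicator)
  also have "\<dots> \<le> (\<integral>\<^sup>+z\<in>?B. ext_diff (ereal (u z)) (ereal c) \<partial>M)"
    using y(2) side(2)[OF y(1)]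
    by (intro nn_integral_mono) (auto simp: indicator_def ext_diff_def intro!: ennreal_leI)
  finally have "ennreal (m / 2 * (b / C1 ^ 3)) / emeasure M ?B \<le> (\<integral>\<^sup>+z\<in>?B. ext_diff (ereal (u z)) (ereal c) \<partial>M) / emeasure M ?B"
    by (rule divide_right_mono_ennreal)
  also have "ennreal (m / 2 * (b / C1 ^ 3)) / emeasure M ?B = ennreal (m / (2 * C1 ^ 3))"
    using b m0 C1 by (simp add: divide_ennreal)
  also have "(\<integral>\<^sup>+z\<in>?B. ext_diff (ereal (u z)) (ereal c) \<partial>M) / emeasure M ?B
    \<le> ennreal (C2 * (3 * r)) *
             enn_powr ((\<integral>\<^sup>+z\<in>?LB. enn_powr (ennreal (g z)) p \<partial>M)
                        / emeasure M ?LB) (1 / p)"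
  proof -
    have "integrable_ext M ?LB (\<lambda>y. ereal (u y))"
      unfolding integrable_ext_def
    proof
      show "(\<lambda>y. ereal (u y)) \<in> borel_measurable (restrict_space M ?LB)"
        using um by (intro measurable_restrict_space1 line_measure_measurable[OF M]) measurable
      have "(\<integral>\<^sup>+z\<in>?LB. e2ennreal \<bar>ereal (u z)\<bar> \<partial>M) \<le> (\<integral>\<^sup>+z. ennreal m * indicator ?LB z \<partial>M)"
        using u_bounds by (intro nn_integral_mono) (auto simp: indicator_def e2ennreal_ereal intro!: ennreal_leI)
      also have "\<dots> = ennreal m * ennreal bL"
        using line_measure_ball[OF M L3] bL by (simp add: nn_integral_cmult_indicator)
      also have "\<dots> < \<infinity>" by (simp add: ennreal_mult_less_top)
      finally show "(\<integral>\<^sup>+z\<in>?LB. e2ennreal \<bar>ereal (u z)\<bar> \<partial>M) < \<infinity>" .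
    qed
    moreover have "upper_gradient ?LB (\<lambda>y. ereal (u y)) (\<lambda>y. ennreal (g y))"
      unfolding u_def by (intro upper_gradient_indefinite_integral int pos) simp
    ultimately show ?thesis
      unfolding c_def using r by (intro poincare_withD[OF P _ B_sub]) auto
  qed
  \<comment> \<open>The dilation factor \<open>L\<close> is harmless: \<open>g\<close> vanishes
    outside \<open>ball x r\<close>, and the larger ball has at least the measure \<open>bs\<close>
    of \<open>ball x r\<close>.\<close>
  also have "\<dots> \<le> ennreal (C2 * (3 * r)) * enn_powr (ennreal (G / bs)) (1 / p)"
  proof (intro mult_left_mono enn_powr_mono)
    have "(\<integral>\<^sup>+z\<in>?LB. enn_powr (ennreal (g z)) p \<partial>M) \<le> ennreal G"
      unfolding G(1)[symmetric] using p pos by (intro nn_integral_mono) (auto simp: indicator_def)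
    then have "(\<integral>\<^sup>+z\<in>?LB. enn_powr (ennreal (g z)) p \<partial>M) / emeasure M ?LB \<le> ennreal G / emeasure M ?LB"
      by (rule divide_right_mono_ennreal)
    also have "\<dots> = ennreal (G / bL)" using bL G by (simp add: divide_ennreal)
    also have "\<dots> \<le> ennreal (G / bs)"
    proof -
      have "r \<le> L * (3 * r)" using L r mult_mono[of 1 L r "3 * r"] by simp
      then have "emeasure M (ball x r) \<le> emeasure M ?LB"
        using L3 by (intro emeasure_mono subset_ball line_measure_ball(1)[OF M]) auto
      then have "bs \<le> bL" using bs bL by (simp add: ennreal_le_iff)
      then show ?thesis using bs G by (intro ennreal_leI divide_left_mono) auto
    qed
    finally show "(\<integral>\<^sup>+z\<in>?LB. enn_powr (ennreal (g z)) p \<partial>M) / emeasure M ?LB \<le> ennreal (G / bs)" .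
  qed (use p in auto)
  also have "\<dots> = ennreal (C2 * (3 * r) * (G / bs) powr (1 / p))"
    using C2 r p G bs by (simp add: ennreal_mult')
  finally have "m / (2 * C1 ^ 3) \<le> C2 * (3 * r) * (G / bs) powr (1 / p)"
    using C2 r by (subst (asm) ennreal_le_iff) auto
  then have "m \<le> 6 * C1 ^ 3 * C2 * r * (G / bs) powr (1 / p)"
    using C1 by (simp add: field_simps)
  then have "m powr p \<le> (6 * C1 ^ 3 * C2 * r * (G / bs) powr (1 / p)) powr p"
    using m0 p by (intro powr_mono2) auto
  also have "\<dots> = (6 * C1 ^ 3 * C2 * r) powr p * (G / bs)"
  proof -
    have "((G / bs) powr (1 / p)) powr p = G / bs" using p G bs by (simp add: powr_powr)
    moreover have "0 \<le> 6 * C1 ^ 3 * C2 * r" using C1 C2 r by simp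
    ultimately show ?thesis by (simp only: powr_mult powr_ge_zero)
  qed
  finally show ?thesis
    using bs unfolding m_def[symmetric] by (simp add: measure_def field_simps)
qed

section \<open>Absolute continuity and the existence of a weight\<close>

text \<open>Radon-Nikodym yields a density with respect to \<open>lborel\<close>, while
  \<open>has_weight\<close> refers to \<open>lebesgue\<close>; this bridges the two. A set of
  \<open>completion M\<close> differs from one of \<open>M\<close> by part of a null set, which both
  density measures ignore.\<close>

lemma completion_density_completion:
  assumes f[measurable]: "f \<in> borel_measurable M"
  shows "completion (density (completion M) f) = completion (density M f)" (is "completion ?D2 = completion ?D1")
proof -
  have f2[measurable]: "f \<in> borel_measurable (completion M)" by (intro measurable_completion f)
  have em: "emeasure ?D2 S = emeasure ?D1 S" if "S \<in> sets M" for S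
    using that by (simp add: emeasure_density nn_integral_completion)
  have null: "Z \<in> null_sets ?D1" if "Z \<in> null_sets M" for Z
    using that absolutely_continuousI_density[OF f] by (auto simp: absolutely_continuous_def)
  have null2: "Z \<in> null_sets ?D2" if "Z \<in> null_sets ?D1" for Z
    using that em by (auto simp: null_sets_def)
  have D2: "A \<in> sets (completion ?D1)" "emeasure (completion ?D1) A = emeasure ?D2 A" if A: "A \<in> sets (completion M)" for A
  proof -
    obtain S N N' where A': "A = S \<union> N" "N \<subseteq> N'" "N' \<in> null_sets M" "S \<in> sets M"
      using A by (rule sets_completionE)
    show "A \<in> sets (completion ?D1)"
      by (rule sets_completionI[of A S N N']) (use A' null in auto)
    have "N \<in> null_sets (completion ?D1)"
      using A' null null_sets_completionI null_sets_completion_subset by metis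
    then have "emeasure (completion ?D1) A = emeasure (completion ?D1) S"
      unfolding A'(1) using A'(4) by (intro emeasure_Un_null_set) auto
    also have "\<dots> = emeasure ?D2 S" using A'(4) em by simp
    also have "\<dots> = emeasure ?D2 A"
    proof -
      have "N \<in> null_sets (completion M)"
        using A' null_sets_completionI null_sets_completion_subset by metis
      then have "N \<in> null_sets ?D2"
        using absolutely_continuousI_density[OF f2] by (auto simp: absolutely_continuous_def)
      then show ?thesis
        unfolding A'(1) using A'(4) by (intro emeasure_Un_null_set[symmetric]) auto
    qed
    finally show "emeasure (completion ?D1) A = emeasure ?D2 A" .
  qed
  have sub1: "A \<in> sets (completion ?D1)" if A: "A \<in> sets (completion ?D2)" for A
  proof -
    obtain S N N' where A': "A = S \<union> N" "N \<subseteq> N'" "N' \<in> null_sets ?D2" "S \<in> sets ?D2"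
      using A by (rule sets_completionE)
    have "N' \<in> null_sets (completion ?D1)"
      using A'(3) D2[of N'] by (auto simp: null_sets_def)
    then have "N \<in> null_sets (completion ?D1)" using A'(2) null_sets_completion_subset by metis
    then show ?thesis using A'(1,4) D2(1)[of S] by auto
  qed
  have sub2: "A \<in> sets (completion ?D2) \<and> emeasure (completion ?D2) A = emeasure (completion ?D1) A"
    if A: "A \<in> sets (completion ?D1)" for A
  proof -
    obtain S N N' where A': "A = S \<union> N" "N \<subseteq> N'" "N' \<in> null_sets ?D1" "S \<in> sets ?D1"
      using A by (rule sets_completionE)
    have N: "N \<in> null_sets (completion ?D1)" "N \<in> null_sets (completion ?D2)"
      using A' null2 null_sets_completionI null_sets_completion_subset by metis+
    have S: "S \<in> sets (completion ?D2)" "S \<in> sets (completion ?D1)"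
      using A'(4) by auto
    have "emeasure (completion ?D2) A = emeasure (completion ?D2) S"
      "emeasure (completion ?D1) A = emeasure (completion ?D1) S"
      unfolding A'(1) by (intro emeasure_Un_null_set S N)+
    moreover have "emeasure (completion ?D2) S = emeasure (completion ?D1) S"
      using A'(4) em by simp
    ultimately show ?thesis using S N A'(1) by auto
  qed
  show ?thesis
  proof (rule measure_eqI)
    show "sets (completion ?D2) = sets (completion ?D1)" using sub1 sub2 by blast
    show "emeasure (completion ?D2) A = emeasure (completion ?D1) A" if "A \<in> sets (completion ?D2)" for A
      using sub1[OF that] sub2 by blast
  qed
qed

text \<open>A form of \<open>mean_inequality\<close> raised to the power \<open>p\<close>, for
  bounded real test functions supported in the ball; the Poincare inequality for an antiderivative
  of \<open>g\<close> yields it directly. The bound \<open>b\<close> makes the test functions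
  integrable.\<close>

definition integral_inequality :: "real \<Rightarrow> real \<Rightarrow> real measure \<Rightarrow> real \<Rightarrow> real \<Rightarrow> bool" where
  "integral_inequality K p M x r \<longleftrightarrow>
     (\<forall>g b G. g \<in> borel_measurable borel \<longrightarrow> (\<forall>t. 0 \<le> g t \<and> g t \<le> b) \<longrightarrow> (\<forall>t. t \<notin> ball x r \<longrightarrow> g t = 0) \<longrightarrow>
        (\<integral>\<^sup>+t. ennreal (g t powr p) \<partial>M) = ennreal G \<longrightarrow> 0 \<le> G \<longrightarrow>
        (LINT t|lborel. g t) powr p * measure M (ball x r) \<le> K * r powr p * G)"

lemma integral_inequalityD:
  assumes "integral_inequality K p M x r" "g \<in> borel_measurable borel" "\<And>t. 0 \<le> g t" "\<And>t. g t \<le> b"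
    "\<And>t. t \<notin> ball x r \<Longrightarrow> g t = 0" "(\<integral>\<^sup>+t. ennreal (g t powr p) \<partial>M) = ennreal G" "0 \<le> G"
  shows "(LINT t|lborel. g t) powr p * measure M (ball x r) \<le> K * r powr p * G"
  using assms unfolding integral_inequality_def by blast

lemma integrable_bounded_on_ball:
  fixes g :: "real \<Rightarrow> real"
  assumes "g \<in> borel_measurable borel" "\<And>t. 0 \<le> g t" "\<And>t. g t \<le> b" "\<And>t. t \<notin> ball x r \<Longrightarrow> g t = 0"
  shows "integrable lborel g"
proof (rule integrableI_bounded_set[where A="ball x r" and B=b])
  show "emeasure lborel (ball x r) < \<infinity>" by (rule emeasure_lborel_ball_finite)
qed (use assms in \<open>auto intro!: AE_I2\<close>)

lemma admissible_within_integral_inequality: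
  assumes p: "1 \<le> p" and M: "line_measure M" and adm: "admissible_within p M (ball x0 R)"
  obtains K where "0 < K"
    "\<And>x r. 0 < r \<Longrightarrow> ball x r \<subseteq> ball x0 (R / 8) \<Longrightarrow> integral_inequality K p M x r"
proof -
  obtain C1 C2 L where C: "0 < C1" "doubling_with C1 M (ball x0 R)" "0 < C2" "1 \<le> L"
      "poincare_with C2 L p M (ball x0 R)"
    using adm by (auto simp: admissible_within_def)
  show ?thesis
  proof
    show "0 < (6 * C1 ^ 3 * C2) powr p" using C by simp
    show "integral_inequality ((6 * C1 ^ 3 * C2) powr p) p M x r"
      if r: "0 < r" "ball x r \<subseteq> ball x0 (R / 8)" for x r
      unfolding integral_inequality_def
    proof (intro allI impI)
      fix g :: "real \<Rightarrow> real" and b G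
      assume g: "g \<in> borel_measurable borel" "\<forall>t. 0 \<le> g t \<and> g t \<le> b" "\<forall>t. t \<notin> ball x r \<longrightarrow> g t = 0"
        and G: "(\<integral>\<^sup>+t. ennreal (g t powr p) \<partial>M) = ennreal G" "0 \<le> G"
      have "(LINT t|lborel. g t) powr p * measure M (ball x r) \<le> (6 * C1 ^ 3 * C2 * r) powr p * G"
        using g by (intro integral_bound_admissible[OF p M C(2,1,5,3,4) r] G integrable_bounded_on_ball) auto
      then show "(LINT t|lborel. g t) powr p * measure M (ball x r) \<le> (6 * C1 ^ 3 * C2) powr p * r powr p * G"
        using C r by (simp add: powr_mult)
    qed
  qed
qed

text \<open>Testing with the indicator of \<open>B - E\<close>, whose Lebesgue integral is the full
  \<open>2 * r\<close>, bounds the measure of each small ball \<open>B\<close> by a multiple of that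
  of \<open>B - E\<close>. So \<open>N\<close> is dominated on balls by \<open>N2\<close>, a
  multiple of \<open>N\<close> restricted to the complement of \<open>E\<close>, and hence also on
  the part of \<open>E\<close> in the ball, where \<open>N2\<close> vanishes.\<close>

lemma integral_inequality_null_set:
  assumes p: "1 \<le> p" and M: "line_measure M" and K: "0 < K" and R: "0 < R"
    and ii: "\<And>x r. 0 < r \<Longrightarrow> ball x r \<subseteq> ball x0 R \<Longrightarrow> integral_inequality K p M x r"
    and N: "sets N = sets borel" "M = completion N"
    and E: "E \<in> null_sets lborel"
  shows "E \<inter> ball x0 R \<in> null_sets N"
proof -
  have [measurable]: "E \<in> sets borel" using E by auto
  have NM: "emeasure M A = emeasure N A" if "A \<in> sets borel" for A
    using that N by simp
  define c where "c = ennreal (K / 2 powr p)"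
  define N2 where "N2 = density N (\<lambda>y. c * indicator (- E) y)"
  have s2: "sets N2 = sets borel" by (simp add: N2_def N)
  have N2: "emeasure N2 A = c * emeasure N (A - E)" if "A \<in> sets borel" for A
  proof -
    have "emeasure N2 A = (\<integral>\<^sup>+y. c * indicator (A - E) y \<partial>N)"
      unfolding N2_def using that N(1)
      by (subst emeasure_density) (auto intro!: nn_integral_cong simp: indicator_def measurable_cong_sets[OF N(1) refl])
    then show ?thesis using that N(1) by (simp add: nn_integral_cmult_indicator)
  qed
  have "emeasure N (E \<inter> ball x0 R) \<le> emeasure N2 (E \<inter> ball x0 R)"
  proof (rule emeasure_le_of_balls[OF N(1) s2])
    have "emeasure N (ball x0 R - E) \<le> emeasure N (ball x0 R)"
      by (intro emeasure_mono) (auto simp: N)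
    also have "\<dots> < \<infinity>" using line_measure_ball(3)[OF M R, of x0] by (simp add: NM)
    finally show "emeasure N2 (ball x0 R) < \<infinity>"
      by (simp add: N2 c_def ennreal_mult_less_top)
  next
    fix x r :: real assume r: "0 < r" "ball x r \<subseteq> ball x0 R"
    obtain m where m: "0 < m" "emeasure M (ball x r) = ennreal m"
      using line_measure_ball_ennreal[OF M r(1)] by blast
    have "emeasure M (ball x r - E) \<le> emeasure M (ball x r)"
      by (intro emeasure_mono line_measure_ball(1)[OF M r(1)]) auto
    then obtain m' where m': "0 \<le> m'" "emeasure M (ball x r - E) = ennreal m'"
      using m by (cases "emeasure M (ball x r - E)") (auto simp: top_unique)
    define g where "g y = indicat_real (ball x r - E) y" for y
    have "(\<integral>\<^sup>+t. ennreal (g t powr p) \<partial>M) = (\<integral>\<^sup>+t. indicator (ball x r - E) t \<partial>M)"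
      using p by (intro nn_integral_cong) (auto simp: g_def indicator_def)
    also have "\<dots> = ennreal m'"
      using m'(2) N by (subst nn_integral_indicator) auto
    finally have G: "(\<integral>\<^sup>+t. ennreal (g t powr p) \<partial>M) = ennreal m'" .
    have "(LINT t|lborel. g t) = measure lborel (ball x r - E)"
      unfolding g_def by (subst Bochner_Integration.integral_indicator) auto
    also have "\<dots> = 2 * r"
      using r E by (simp add: measure_def emeasure_Diff_null_set emeasure_lborel_ball)
    finally have I: "(LINT t|lborel. g t) = 2 * r" .
    have "(LINT t|lborel. g t) powr p * measure M (ball x r) \<le> K * r powr p * m'"
      by (rule integral_inequalityD[OF ii[OF r], where b=1])
        (auto simp: G m'(1), auto simp: g_def indicator_def)
    then have "(2 * r) powr p * m \<le> K * r powr p * m'"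
      using m by (simp add: I measure_def)
    then have "m \<le> K / 2 powr p * m'"
      using r by (simp add: powr_mult field_simps)
    then have "ennreal m \<le> c * ennreal m'"
      using K m'(1) unfolding c_def by (subst ennreal_mult[symmetric]) (auto intro!: ennreal_leI)
    then show "emeasure N (ball x r) \<le> emeasure N2 (ball x r)"
      using m m' by (simp add: N2 NM)
  qed auto
  also have "\<dots> = 0" by (subst N2) (auto simp: Diff_eq)
  finally show ?thesis by (auto simp: null_sets_def N)
qed

text \<open>Each point has a ball within which Lebesgue null sets are null for \<open>N\<close>. By
  Lindelof countably many of these balls cover the line, so \<open>N\<close> is absolutely
  continuous and Radon-Nikodym applies.\<close>

lemma locally_admissible_has_weight:
  assumes p: "1 \<le> p" and M: "line_measure M" and adm: "locally_admissible p M"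
  obtains w where "w \<in> borel_measurable borel" "has_weight M w"
proof -
  obtain N where N: "sets N = sets borel" "M = completion N"
    using M unfolding line_measure_def by blast
  have "\<exists>R>0. \<forall>E\<in>null_sets lborel. E \<inter> ball x0 R \<in> null_sets N" for x0
  proof -
    obtain R where R: "0 < R" "admissible_within p M (ball x0 R)"
      using adm unfolding locally_admissible_def holds_locally_def by blast
    obtain K where K: "0 < K"
      "\<And>x r. 0 < r \<Longrightarrow> ball x r \<subseteq> ball x0 (R / 8) \<Longrightarrow> integral_inequality K p M x r"
      using admissible_within_integral_inequality[OF p M R(2)] by blast
    show ?thesis
      using R(1) integral_inequality_null_set[OF p M K(1) _ K(2) N] by (intro exI[of _ "R/8"]) auto
  qed
  then obtain R where R: "\<And>x. 0 < R x" "\<And>x E. E \<in> null_sets lborel \<Longrightarrow> E \<inter> ball x (R x) \<in> null_sets N"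
    by metis
  obtain F' where F': "F' \<subseteq> range (\<lambda>x. ball x (R x))" "countable F'" "\<Union>F' = \<Union>(range (\<lambda>x. ball x (R x)))"
    using Lindelof[of "range (\<lambda>x. ball x (R x))"] by auto
  have U: "\<Union>F' = UNIV" using R(1) unfolding F'(3) by (auto intro!: UN_I simp: dist_self)
  have "absolutely_continuous lborel N"
    unfolding absolutely_continuous_def
  proof
    fix E :: "real set" assume E: "E \<in> null_sets lborel"
    have "(\<Union>S\<in>F'. E \<inter> S) \<in> null_sets N"
      using F'(1) R(2)[OF E] by (intro null_sets_UN' F'(2)) auto
    also have "(\<Union>S\<in>F'. E \<inter> S) = E" using U by auto
    finally show "E \<in> null_sets N" .
  qed
  then obtain w where w: "w \<in> borel_measurable lborel" "density lborel w = N"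
    using sigma_finite_measure.Radon_Nikodym[OF sigma_finite_lborel, of N] N by auto
  show ?thesis
  proof
    show "w \<in> borel_measurable borel" using w by simp
    show "has_weight M w"
      unfolding has_weight_def N(2) w(2)[symmetric] by (rule completion_density_completion[symmetric, OF w(1)])
  qed
qed

section \<open>The Muckenhoupt condition for the density\<close>

lemma SUP_min_of_nat: "(SUP k. min a (of_nat k)) = (a :: ennreal)"
proof -
  have "(SUP k. min a (of_nat k)) = min a (SUP k. of_nat k)"
    by (simp add: inf_SUP flip: inf_min)
  then show ?thesis by (simp add: ennreal_SUP_of_nat_eq_top)
qed

text \<open>With \<open>\<sigma>\<close> the power \<open>1 / (1 - p)\<close> of \<open>w\<close>
  one has \<open>w * \<sigma> powr (p - 1) = 1\<close> for positive finite \<open>w\<close>, and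
  truncating \<open>\<sigma>\<close> only lowers this product. If \<open>w\<close> is 0 the
  left-hand side is 0; if \<open>w\<close> is infinite, \<open>\<sigma>\<close> is 0.\<close>

lemma truncated_dual_powr_le:
  assumes p: "1 < p"
  shows "w * ennreal (enn2real (min (enn_powr w (1 / (1 - p))) (of_nat k)) powr p)
    \<le> ennreal (enn2real (min (enn_powr w (1 / (1 - p))) (of_nat k)))" (is "w * ennreal (?g powr p) \<le> ennreal ?g")
proof -
  have q: "1 / (1 - p) < 0" using p by simp
  consider "w = 0" | "w = \<infinity>" | a where "w = ennreal a" "0 < a"
    by (cases w) (auto simp: less_le)
  then show ?thesis
  proof cases
    case 2
    then show ?thesis using q by (simp add: enn_powr_def)
  next
    case 3
    define h where "h = min (a powr (1 / (1 - p))) (real k)"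
    have h: "0 \<le> h" "h \<le> a powr (1 / (1 - p))" by (auto simp: h_def)
    have "min (enn_powr w (1 / (1 - p))) (of_nat k) = ennreal h"
      using 3 by (simp add: enn_powr_ennreal_pos h_def ennreal_of_nat_eq_real_of_nat min_def ennreal_le_iff)
    then have g: "?g = h" using h by simp
    have "a * h powr p \<le> h"
    proof (cases "h = 0")
      case False
      have "h powr (p - 1) \<le> (a powr (1 / (1 - p))) powr (p - 1)"
        using h p by (intro powr_mono2) auto
      also have "\<dots> = a powr (-1)"
      proof -
        have "1 / (1 - p) * (p - 1) = -1" using p by (simp add: field_simps)
        then show ?thesis by (simp only: powr_powr)
      qed
      also have "\<dots> = 1 / a" using 3 by (simp add: powr_minus field_simps)
      finally have "a * h powr (p - 1) \<le> 1" using 3 by (simp add: field_simps)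
      then have "a * h powr (p - 1) * h \<le> 1 * h" using h by (intro mult_right_mono) auto
      moreover have "h powr p = h powr (p - 1) * h"
        using h False by (simp add: powr_diff)
      ultimately show ?thesis by simp
    qed (use p in simp)
    then show ?thesis unfolding g using 3 h by (subst 3, subst ennreal_mult[symmetric]) (auto intro!: ennreal_leI)
  qed simp
qed

definition Ap_ball :: "real \<Rightarrow> real \<Rightarrow> (real \<Rightarrow> ennreal) \<Rightarrow> real \<Rightarrow> real \<Rightarrow> bool" where
  "Ap_ball C p w x r \<longleftrightarrow>
     (\<integral>\<^sup>+y\<in>ball x r. w y \<partial>lebesgue) / emeasure lebesgue (ball x r)
        < ennreal C *
          (if p = 1 then ess_inf_on lebesgue (ball x r) w
           else enn_powr ((\<integral>\<^sup>+y\<in>ball x r. enn_powr (w y) (1 / (1 - p)) \<partial>lebesgue)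
                           / emeasure lebesgue (ball x r)) (1 - p))"

lemma Ap_with_iff: "Ap_with C p w B0 \<longleftrightarrow> (\<forall>x r. 0 < r \<and> ball x r \<subseteq> B0 \<longrightarrow> Ap_ball C p w x r)"
  by (simp add: Ap_with_def Ap_ball_def)

text \<open>The factor 2 makes the inequality in \<^const>\<open>Ap_ball\<close> strict.\<close>

lemma Ap_ball_integral_inequality:
  assumes p: "1 \<le> p" and M: "line_measure M" and K: "0 < K" and r: "0 < r"
    and ii: "integral_inequality K p M x r"
    and wb[measurable]: "w \<in> borel_measurable borel" and hw: "has_weight M w"
  shows "Ap_ball (2 * K) p w x r"
proof -
  let ?B = "ball x r"
  have wt: "weight w" unfolding weight_def using wb by (intro measurable_completion) simp
  obtain m where m: "0 < m" "emeasure M ?B = ennreal m"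
    using line_measure_ball_ennreal[OF M r] by blast
  have W: "(\<integral>\<^sup>+y\<in>?B. w y \<partial>lebesgue) / emeasure lebesgue ?B = ennreal (m / (2 * r))"
  proof -
    have "(\<integral>\<^sup>+y\<in>?B. w y \<partial>lebesgue) = ennreal m"
      using emeasure_has_weight[OF hw wt, of ?B] m by simp
    then show ?thesis using m r by (simp add: emeasure_lborel_ball divide_ennreal)
  qed
  show ?thesis
  proof (cases "p = 1")
    case True
    \<comment> \<open>With this \<open>c\<close> the product \<open>K * r * c\<close> is
      \<open>m / 2\<close>. If \<open>w < c\<close> held on a set \<open>A\<close> of positive
      measure, the indicator of \<open>A\<close> as test function would give
      \<open>m \<le> K * r * c\<close>.\<close>
    define c where "c = m / (2 * K * r)"
    have c: "0 < c" using m r K by (simp add: c_def)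
    have "AE y in lborel. y \<in> ?B \<longrightarrow> ennreal c \<le> w y"
    proof (rule ccontr)
      assume contra: "\<not> (AE y in lborel. y \<in> ?B \<longrightarrow> ennreal c \<le> w y)"
      define A where "A = {y \<in> ?B. w y < ennreal c}"
      have [measurable]: "A \<in> sets borel" unfolding A_def by measurable
      have fin: "emeasure lborel A < \<infinity>"
      proof -
        have "emeasure lborel A \<le> emeasure lborel ?B" by (intro emeasure_mono) (auto simp: A_def)
        then show ?thesis using emeasure_lborel_ball_finite[of x r] by (rule le_less_trans)
      qed
      have A0: "0 < measure lborel A"
      proof (rule ccontr)
        assume "\<not> 0 < measure lborel A"
        then have "emeasure lborel A = 0"
          using fin by (simp add: measure_def enn2real_positive_iff)
        then have "A \<in> null_sets lborel" by auto
        then have "AE y in lborel. y \<notin> A" by (rule AE_not_in)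
        then have "AE y in lborel. y \<in> ?B \<longrightarrow> ennreal c \<le> w y"
          by eventually_elim (auto simp: A_def)
        with contra show False by blast
      qed
      define g where "g y = indicat_real A y" for y
      have "(\<integral>\<^sup>+t. ennreal (g t powr p) \<partial>M) = (\<integral>\<^sup>+t. w t * ennreal (g t powr p) \<partial>lebesgue)"
        by (rule nn_integral_has_weight[OF hw wt]) (simp add: g_def)
      also have "\<dots> \<le> (\<integral>\<^sup>+t. ennreal c * indicator A t \<partial>lebesgue)"
        using True by (intro nn_integral_mono) (auto simp: g_def indicator_def A_def)
      also have "\<dots> = ennreal (c * measure lborel A)"
        using fin c by (simp add: nn_integral_completion nn_integral_cmult_indicator emeasure_eq_ennreal_measure ennreal_mult)
      finally have le: "(\<integral>\<^sup>+t. ennreal (g t powr p) \<partial>M) \<le> ennreal (c * measure lborel A)" .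
      then obtain G where G: "0 \<le> G" "(\<integral>\<^sup>+t. ennreal (g t powr p) \<partial>M) = ennreal G"
        by (cases "(\<integral>\<^sup>+t. ennreal (g t powr p) \<partial>M)") (auto simp: top_unique)
      have Gc: "G \<le> c * measure lborel A" using le G c by (simp add: ennreal_le_iff)
      have "(LINT t|lborel. g t) powr p * measure M ?B \<le> K * r powr p * G"
        by (rule integral_inequalityD[OF ii, where b=1]) (auto simp: G, auto simp: g_def indicator_def A_def)
      moreover have "(LINT t|lborel. g t) = measure lborel A"
        unfolding g_def by simp
      ultimately have "measure lborel A * m \<le> K * r * G"
        using True m r by (simp add: measure_def)
      also have "\<dots> \<le> K * r * (c * measure lborel A)"
        using K r Gc by (intro mult_left_mono) auto
      finally have "m \<le> K * r * c" using A0 by simp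
      then show False using m K r by (simp add: c_def)
    qed
    then have "ennreal c \<le> ess_inf_on lebesgue ?B w"
      unfolding ess_inf_on_def by (intro Sup_upper) (simp add: AE_completion)
    then have "ennreal (2 * K) * ennreal c \<le> ennreal (2 * K) * ess_inf_on lebesgue ?B w"
      by (rule mult_left_mono) simp
    moreover have "ennreal (2 * K) * ennreal c = ennreal (m / r)"
      using K c by (subst ennreal_mult[symmetric]) (auto simp: c_def)
    moreover have "ennreal (m / (2 * r)) < ennreal (m / r)"
      using m r by (intro ennreal_lessI) (auto simp: field_simps)
    ultimately show ?thesis using True unfolding Ap_ball_def W by simp
  next
    case False
    then have p1: "1 < p" using p by simp
    define \<sigma> where "\<sigma> y = enn_powr (w y) (1 / (1 - p))" for y
    have [measurable]: "\<sigma> \<in> borel_measurable borel"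
      unfolding \<sigma>_def by (rule measurable_compose[OF wb borel_measurable_enn_powr])
    \<comment> \<open>Truncation at height \<open>k\<close> makes the integral \<open>I\<close> of
      \<open>g k\<close> finite, so that \<open>I powr p * m \<le> K * r powr p * I\<close> can be
      divided by a nonzero \<open>I\<close>. Monotone convergence removes the truncation
      afterwards.\<close>
    define g where "g k y = enn2real (min (\<sigma> y) (of_nat k)) * indicat_real ?B y" for k y
    have g_meas[measurable]: "g k \<in> borel_measurable borel" for k
    proof -
      have [measurable]: "?B \<in> sets borel" by simp
      show ?thesis unfolding g_def by measurable
    qed
    have g_pos: "0 \<le> g k y" for k y by (simp add: g_def)
    have fin: "min (\<sigma> y) (of_nat k) < top" for k y
      by (simp add: min_less_iff_disj of_nat_less_top)
    have g_le: "g k y \<le> real k" for k y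
    proof -
      have "enn2real (min (\<sigma> y) (of_nat k)) \<le> enn2real (of_nat k)"
        by (intro enn2real_mono) (auto simp: of_nat_less_top)
      then show ?thesis by (auto simp: g_def indicator_def)
    qed
    have g_enn: "ennreal (g k y) = min (\<sigma> y) (of_nat k) * indicator ?B y" for k y
      using fin[of y k] by (auto simp: g_def indicator_def)
    \<comment> \<open>\<open>T\<close> solves
      \<open>T powr (p - 1) * m = K * r powr p\<close>.\<close>
    define T where "T = (K * r powr p / m) powr (1 / (p - 1))"
    have T: "0 < T" using K r m by (simp add: T_def)
    have bound: "(\<integral>\<^sup>+y. ennreal (g k y) \<partial>lebesgue) \<le> ennreal T" for k
    proof -
      have int: "integrable lborel (g k)"
        by (rule integrable_bounded_on_ball[OF g_meas g_pos g_le, where x=x and r=r]) (simp add: g_def)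
      define I where "I = (LINT y|lborel. g k y)"
      have I0: "0 \<le> I" unfolding I_def by (intro integral_nonneg_AE) (simp add: g_pos)
      have I: "(\<integral>\<^sup>+y. ennreal (g k y) \<partial>lebesgue) = ennreal I"
        unfolding I_def nn_integral_completion using int by (intro nn_integral_eq_integral) (auto simp: g_pos)
      have "(\<integral>\<^sup>+t. ennreal (g k t powr p) \<partial>M) = (\<integral>\<^sup>+t. w t * ennreal (g k t powr p) \<partial>lebesgue)"
        by (rule nn_integral_has_weight[OF hw wt]) simp
      also have "\<dots> \<le> (\<integral>\<^sup>+t. ennreal (g k t) \<partial>lebesgue)"
        using truncated_dual_powr_le[OF p1] p1
        by (intro nn_integral_mono) (auto simp: g_def \<sigma>_def indicator_def)
      finally have le: "(\<integral>\<^sup>+t. ennreal (g k t powr p) \<partial>M) \<le> ennreal I" by (simp only: I)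
      then obtain G where G: "0 \<le> G" "(\<integral>\<^sup>+t. ennreal (g k t powr p) \<partial>M) = ennreal G"
        by (cases "(\<integral>\<^sup>+t. ennreal (g k t powr p) \<partial>M)") (auto simp: top_unique)
      have GI: "G \<le> I" using le G I0 by (simp add: ennreal_le_iff)
      have "I powr p * measure M ?B \<le> K * r powr p * G"
        unfolding I_def by (rule integral_inequalityD[OF ii g_meas g_pos g_le _ G(2,1)]) (simp add: g_def)
      also have "\<dots> \<le> K * r powr p * I" using K GI by (intro mult_left_mono) auto
      finally have ineq: "I powr p * m \<le> K * r powr p * I" using m by (simp add: measure_def)
      have "I \<le> T"
      proof (cases "I = 0")
        case False
        then have I1: "0 < I" using I0 by simp
        then have "I powr (p - 1) * m * I \<le> K * r powr p * I"
          using ineq by (simp add: powr_diff)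
        then have "I powr (p - 1) * m \<le> K * r powr p" using I1 by simp
        then have "I powr (p - 1) \<le> K * r powr p / m" using m by (simp add: field_simps)
        then have "(I powr (p - 1)) powr (1 / (p - 1)) \<le> T"
          unfolding T_def using p1 by (intro powr_mono2) auto
        then show ?thesis using p1 I1 by (simp add: powr_powr)
      qed (use T in simp)
      then show ?thesis unfolding I by (rule ennreal_leI)
    qed
    have "(\<integral>\<^sup>+y\<in>?B. \<sigma> y \<partial>lebesgue) = (\<integral>\<^sup>+y. (SUP k. ennreal (g k y)) \<partial>lborel)"
      unfolding nn_integral_completion
    proof (intro nn_integral_cong)
      fix y
      show "\<sigma> y * indicator ?B y = (SUP k. ennreal (g k y))"
        unfolding g_enn by (cases "y \<in> ?B") (auto simp: SUP_min_of_nat)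
    qed
    also have "\<dots> = (SUP k. \<integral>\<^sup>+y. ennreal (g k y) \<partial>lborel)"
    proof (rule nn_integral_monotone_convergence_SUP)
      show "incseq (\<lambda>k y. ennreal (g k y))"
        unfolding g_enn incseq_def le_fun_def
        by (auto intro!: mult_right_mono min.mono)
    qed simp
    also have "\<dots> \<le> ennreal T" using bound by (intro SUP_least) (simp add: nn_integral_completion)
    finally have S: "(\<integral>\<^sup>+y\<in>?B. \<sigma> y \<partial>lebesgue) \<le> ennreal T" .
    have e: "(T / (2 * r)) powr (1 - p) = m / (K * r powr p) * (2 * r) powr (p - 1)"
    proof -
      have "1 / (p - 1) * (1 - p) = - 1" using p1 by (simp add: field_simps)
      then have "T powr (1 - p) = m / (K * r powr p)"
        unfolding T_def powr_powr using K r m by (simp add: powr_minus)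
      moreover have "(2 * r) powr (1 - p) = 1 / (2 * r) powr (p - 1)"
        using powr_minus[of "2 * r" "p - 1"] r by (simp add: field_simps)
      ultimately show ?thesis using T r by (simp add: powr_divide)
    qed
    have "(\<integral>\<^sup>+y\<in>?B. \<sigma> y \<partial>lebesgue) / emeasure lebesgue ?B \<le> ennreal T / emeasure lebesgue ?B"
      by (intro divide_right_mono_ennreal S)
    also have "\<dots> = ennreal (T / (2 * r))"
      using T r by (simp add: emeasure_lborel_ball divide_ennreal)
    finally have "enn_powr (ennreal (T / (2 * r))) (1 - p)
        \<le> enn_powr ((\<integral>\<^sup>+y\<in>?B. \<sigma> y \<partial>lebesgue) / emeasure lebesgue ?B) (1 - p)"
      using p1 by (intro enn_powr_antimono) auto
    then have lower: "ennreal (2 * K) * ennreal (m / (K * r powr p) * (2 * r) powr (p - 1))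
        \<le> ennreal (2 * K) * enn_powr ((\<integral>\<^sup>+y\<in>?B. \<sigma> y \<partial>lebesgue) / emeasure lebesgue ?B) (1 - p)"
      using T r by (intro mult_left_mono) (simp_all only: enn_powr_ennreal_pos divide_pos_pos e zero_le mult_pos_pos zero_less_numeral)
    have "m / (2 * r) < 2 * K * (m / (K * r powr p) * (2 * r) powr (p - 1))"
    proof -
      have "r powr p = r powr (p - 1) * r" using r by (simp add: powr_diff)
      then have "2 * K * (m / (K * r powr p) * (2 * r) powr (p - 1)) = 2 * 2 powr (p - 1) * m / r"
        using K r by (simp add: powr_mult field_simps)
      moreover have "1 \<le> 2 powr (p - 1)" using p1 by (simp add: ge_one_powr_ge_zero)
      then have "m / (2 * r) < 2 * 2 powr (p - 1) * m / r"
        using m r by (simp add: field_simps)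
      ultimately show ?thesis by simp
    qed
    then have "ennreal (m / (2 * r)) < ennreal (2 * K) * ennreal (m / (K * r powr p) * (2 * r) powr (p - 1))"
      using m r K by (subst ennreal_mult[symmetric]) (auto intro!: ennreal_lessI)
    then show ?thesis using False lower unfolding Ap_ball_def W \<sigma>_def by simp
  qed
qed

section \<open>Local admissibility against local Muckenhoupt weights\<close>

lemma locally_admissible_imp_local_Ap:
  assumes p: "1 \<le> p" and M: "line_measure M" and adm: "locally_admissible p M"
  shows "\<exists>w. has_weight M w \<and> local_Ap_weight p w"
proof -
  obtain w where w: "w \<in> borel_measurable borel" "has_weight M w"
    using locally_admissible_has_weight[OF p M adm] by blast
  have "holds_locally (\<lambda>B0. \<exists>C>0. Ap_with C p w B0)"
    unfolding holds_locally_def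
  proof
    fix x0
    obtain R where R: "0 < R" "admissible_within p M (ball x0 R)"
      using adm unfolding locally_admissible_def holds_locally_def by blast
    obtain K where K: "0 < K"
      "\<And>x r. 0 < r \<Longrightarrow> ball x r \<subseteq> ball x0 (R / 8) \<Longrightarrow> integral_inequality K p M x r"
      using admissible_within_integral_inequality[OF p M R(2)] by blast
    have "Ap_with (2 * K) p w (ball x0 (R / 8))"
      unfolding Ap_with_iff using Ap_ball_integral_inequality[OF p M K(1) _ K(2) w] by blast
    then show "\<exists>R>0. \<exists>C>0. Ap_with C p w (ball x0 R)"
      using R(1) K(1) by (intro exI[of _ "R / 8"] conjI exI[of _ "2 * K"]) auto
  qed
  moreover have "weight w" unfolding weight_def using w(1) by (intro measurable_completion) simp
  ultimately show ?thesis using w(2) unfolding local_Ap_weight_def by blast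
qed

lemma local_Ap_imp_locally_admissible:
  assumes p: "1 \<le> p" and M: "line_measure M" and hw: "has_weight M w" and Ap: "local_Ap_weight p w"
  shows "locally_admissible p M"
  unfolding locally_admissible_def holds_locally_def
proof
  fix x0
  have w: "weight w" using Ap by (simp add: local_Ap_weight_def)
  obtain R C where R: "0 < R" "0 < C" "Ap_with C p w (ball x0 R)"
    using Ap unfolding local_Ap_weight_def holds_locally_def by blast
  define K where "K = 4 * C powr (1 / p)"
  have K: "0 < K" using R by (simp add: K_def)
  have mi: "mean_inequality K p M x r" if "0 < r" "ball x r \<subseteq> ball x0 R" for x r
    unfolding K_def by (rule mean_inequality_Ap[OF p M hw w R(2,3) that])
  \<comment> \<open>\<open>doubling_with_mean_inequality\<close> gives doubling within a quarter of
    the radius, so both properties are taken within that ball.\<close>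
  have "ball x0 (R / 4) \<subseteq> ball x0 R" using R by (intro subset_ball) simp
  then have "poincare_with K 1 p M (ball x0 (R / 4))"
    by (intro poincare_with_mean_inequality[OF p M] mi) auto
  moreover have "doubling_with (K powr p) M (ball x0 (R / 4))"
    by (rule doubling_with_mean_inequality[OF p M K mi])
  ultimately have "admissible_within p M (ball x0 (R / 4))"
    unfolding admissible_within_def
    using K by (intro conjI exI[of _ "K powr p"] exI[of _ K] exI[of _ 1]) auto
  then show "\<exists>R>0. admissible_within p M (ball x0 R)"
    using R(1) by (intro exI[of _ "R / 4"]) auto
qed

section \<open>Restricting global weights to balls\<close>

lemma Ap_with_cong:
  assumes eq: "\<And>x. x \<in> B0 \<Longrightarrow> w x = w' x"
  shows "Ap_with C p w B0 = Ap_with C p w' B0"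
proof -
  have "(\<integral>\<^sup>+y\<in>B. w y \<partial>lebesgue) = (\<integral>\<^sup>+y\<in>B. w' y \<partial>lebesgue)"
    "(\<integral>\<^sup>+y\<in>B. enn_powr (w y) a \<partial>lebesgue) = (\<integral>\<^sup>+y\<in>B. enn_powr (w' y) a \<partial>lebesgue)"
    "ess_inf_on lebesgue B w = ess_inf_on lebesgue B w'" if "B \<subseteq> B0" for B a
  proof -
    have B: "w y = w' y" if "y \<in> B" for y using that \<open>B \<subseteq> B0\<close> eq by blast
    show "(\<integral>\<^sup>+y\<in>B. w y \<partial>lebesgue) = (\<integral>\<^sup>+y\<in>B. w' y \<partial>lebesgue)"
      "(\<integral>\<^sup>+y\<in>B. enn_powr (w y) a \<partial>lebesgue) = (\<integral>\<^sup>+y\<in>B. enn_powr (w' y) a \<partial>lebesgue)"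
      using B by (auto intro!: nn_integral_cong simp: indicator_def)
    have "(\<lambda>y. y \<in> B \<longrightarrow> c \<le> w y) = (\<lambda>y. y \<in> B \<longrightarrow> c \<le> w' y)" for c using B by auto
    then show "ess_inf_on lebesgue B w = ess_inf_on lebesgue B w'"
      unfolding ess_inf_on_def by presburger
  qed
  then show ?thesis unfolding Ap_with_def by (simp cong: conj_cong imp_cong)
qed

text \<open>Unit balls are bounded intervals, and the Muckenhoupt condition within a ball depends
  only on the values of the weight there.\<close>

lemma local_Ap_if_extends:
  assumes w: "weight w"
    and ext: "\<And>I. is_interval I \<Longrightarrow> bounded I \<Longrightarrow> \<exists>w'. global_Ap_weight p w' \<and> (\<forall>x\<in>I. w' x = w x)"
  shows "local_Ap_weight p w"
  unfolding local_Ap_weight_def holds_locally_def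
proof (intro conjI allI w)
  fix x :: real
  obtain w' where w': "global_Ap_weight p w'" "\<forall>y\<in>ball x 1. w' y = w y"
    using ext[of "ball x 1"] by (auto simp: is_interval_ball_real)
  then obtain C where C: "0 < C" "Ap_with C p w' (ball x 1)"
    unfolding global_Ap_weight_def by (meson zero_less_one)
  then have "Ap_with C p w (ball x 1)"
    using w'(2) Ap_with_cong[of "ball x 1" w' w C p] by simp
  then show "\<exists>R>0. \<exists>C>0. Ap_with C p w (ball x R)"
    using C by (intro exI[of _ 1]) auto
qed

section \<open>Extension of local weights\<close>

lemma Ap_ball_mono: "Ap_ball C p w x r \<Longrightarrow> C \<le> C' \<Longrightarrow> Ap_ball C' p w x r"
  unfolding Ap_ball_def by (erule less_le_trans) (intro mult_right_mono ennreal_leI; simp)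

text \<open>The power \<open>1 - p\<close> is negative for \<open>p > 1\<close>, so an upper bound
  \<open>b\<close> for the average of the dual weight becomes a lower bound for the right-hand side.
  This serves balls on which no Muckenhoupt condition is known beforehand.\<close>

lemma Ap_ballI:
  assumes p: "1 \<le> p" and r: "0 < r" and a: "0 < a" and b: "0 < b" and C: "0 < C"
    and W: "(\<integral>\<^sup>+y\<in>ball x r. w y \<partial>lebesgue) \<le> ennreal (a * (2 * r))"
    and S: "p \<noteq> 1 \<Longrightarrow> (\<integral>\<^sup>+y\<in>ball x r. enn_powr (w y) (1 / (1 - p)) \<partial>lebesgue) \<le> ennreal (b * (2 * r))"
    and c: "p = 1 \<Longrightarrow> AE y in lebesgue. y \<in> ball x r \<longrightarrow> ennreal c \<le> w y" "0 < c"
    and less: "a < C * (if p = 1 then c else b powr (1 - p))"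
  shows "Ap_ball C p w x r"
proof -
  have eB: "emeasure lebesgue (ball x r) = ennreal (2 * r)" using r by (simp add: emeasure_lborel_ball)
  have le: "T / emeasure lebesgue (ball x r) \<le> ennreal t"
    if "T \<le> ennreal (t * (2 * r))" "0 < t" for T t
  proof -
    have "T / emeasure lebesgue (ball x r) \<le> ennreal (t * (2 * r)) / emeasure lebesgue (ball x r)"
      by (rule divide_right_mono_ennreal) (rule that)
    also have "\<dots> = ennreal t" unfolding eB using that r by (subst divide_ennreal) auto
    finally show ?thesis .
  qed
  have "(\<integral>\<^sup>+y\<in>ball x r. w y \<partial>lebesgue) / emeasure lebesgue (ball x r) \<le> ennreal a"
    by (rule le[OF W a])
  also have "\<dots> < ennreal (C * (if p = 1 then c else b powr (1 - p)))"
    using less a by (intro ennreal_lessI) auto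
  also have "\<dots> = ennreal C * ennreal (if p = 1 then c else b powr (1 - p))"
    using C c(2) by (intro ennreal_mult) auto
  also have "\<dots> \<le> ennreal C * (if p = 1 then ess_inf_on lebesgue (ball x r) w
           else enn_powr ((\<integral>\<^sup>+y\<in>ball x r. enn_powr (w y) (1 / (1 - p)) \<partial>lebesgue)
                           / emeasure lebesgue (ball x r)) (1 - p))"
  proof (rule mult_left_mono)
    show "ennreal (if p = 1 then c else b powr (1 - p)) \<le> (if p = 1 then ess_inf_on lebesgue (ball x r) w
           else enn_powr ((\<integral>\<^sup>+y\<in>ball x r. enn_powr (w y) (1 / (1 - p)) \<partial>lebesgue)
                           / emeasure lebesgue (ball x r)) (1 - p))"
    proof (cases "p = 1")
      case True
      then show ?thesis using c(1) unfolding ess_inf_on_def by (simp add: Sup_upper)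
    next
      case False
      then have "enn_powr (ennreal b) (1 - p) \<le> enn_powr ((\<integral>\<^sup>+y\<in>ball x r. enn_powr (w y) (1 / (1 - p)) \<partial>lebesgue)
                           / emeasure lebesgue (ball x r)) (1 - p)"
        using p b by (intro enn_powr_antimono le S) auto
      then show ?thesis using False b by (simp add: enn_powr_ennreal_pos)
    qed
  qed simp
  finally show ?thesis by (simp add: Ap_ball_def)
qed

text \<open>The value 0 at \<open>p = 1\<close> lets the single function
  \<open>w + dual_weight p w\<close> control all integrals in the Muckenhoupt condition for every
  \<open>p\<close>.\<close>

definition dual_weight :: "real \<Rightarrow> (real \<Rightarrow> ennreal) \<Rightarrow> real \<Rightarrow> ennreal" where
  "dual_weight p w y = (if p = 1 then 0 else enn_powr (w y) (1 / (1 - p)))"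

lemma dual_weight_measurable [measurable]:
  assumes "w \<in> borel_measurable lebesgue"
  shows "dual_weight p w \<in> borel_measurable lebesgue"
  unfolding dual_weight_def using measurable_compose[OF assms borel_measurable_enn_powr] by simp

text \<open>A strict inequality has a finite left-hand side and a nonzero right-hand side. The
  latter excludes an infinite dual integral, since \<open>enn_powr \<infinity> (1 - p)\<close> is 0
  for \<open>p > 1\<close>, and makes the essential infimum positive for
  \<open>p = 1\<close>.\<close>

lemma Ap_ball_finite:
  assumes Ap: "Ap_ball C p w x r" and p: "1 \<le> p" and r: "0 < r" and w[measurable]: "w \<in> borel_measurable lebesgue"
  shows "(\<integral>\<^sup>+y\<in>ball x r. w y + dual_weight p w y \<partial>lebesgue) < \<infinity>"
    and "p = 1 \<Longrightarrow> \<exists>c>0. AE y in lebesgue. y \<in> ball x r \<longrightarrow> ennreal c \<le> w y"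
proof -
  have [measurable]: "ball x r \<in> sets lebesgue" by auto
  have eB: "emeasure lebesgue (ball x r) = ennreal (2 * r)" using r by (simp add: emeasure_lborel_ball)
  let ?T = "if p = 1 then ess_inf_on lebesgue (ball x r) w
           else enn_powr ((\<integral>\<^sup>+y\<in>ball x r. enn_powr (w y) (1 / (1 - p)) \<partial>lebesgue)
                           / emeasure lebesgue (ball x r)) (1 - p)"
  have *: "(\<integral>\<^sup>+y\<in>ball x r. w y \<partial>lebesgue) / ennreal (2 * r) < ennreal C * ?T"
    using Ap unfolding Ap_ball_def eB .
  have T0: "?T \<noteq> 0"
  proof
    assume "?T = 0"
    then show False using * by (simp only: mult_zero_right not_less_zero)
  qed
  have W: "(\<integral>\<^sup>+y\<in>ball x r. w y \<partial>lebesgue) \<noteq> \<infinity>"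
  proof
    assume "(\<integral>\<^sup>+y\<in>ball x r. w y \<partial>lebesgue) = \<infinity>"
    then have "(\<integral>\<^sup>+y\<in>ball x r. w y \<partial>lebesgue) / ennreal (2 * r) = \<infinity>"
      by (simp only: infinity_ennreal_def ennreal_top_divide ennreal_neq_top if_False)
    then show False using * by (simp only: infinity_ennreal_def not_top_less)
  qed
  have S: "(\<integral>\<^sup>+y\<in>ball x r. dual_weight p w y \<partial>lebesgue) \<noteq> \<infinity>"
  proof (cases "p = 1")
    case False
    show ?thesis
    proof
      assume "(\<integral>\<^sup>+y\<in>ball x r. dual_weight p w y \<partial>lebesgue) = \<infinity>"
      then have "(\<integral>\<^sup>+y\<in>ball x r. enn_powr (w y) (1 / (1 - p)) \<partial>lebesgue) / ennreal (2 * r) = \<infinity>"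
        using False by (simp only: dual_weight_def infinity_ennreal_def ennreal_top_divide ennreal_neq_top if_False)
      moreover have "enn_powr \<infinity> (1 - p) = 0" using False p by (simp add: enn_powr_def)
      ultimately show False using T0 False by (simp only: eB if_False)
    qed
  qed (simp add: dual_weight_def)
  have "(\<integral>\<^sup>+y\<in>ball x r. w y + dual_weight p w y \<partial>lebesgue)
      = (\<integral>\<^sup>+y\<in>ball x r. w y \<partial>lebesgue) + (\<integral>\<^sup>+y\<in>ball x r. dual_weight p w y \<partial>lebesgue)"
    by (subst nn_integral_add[symmetric]) (auto simp: distrib_right)
  then show "(\<integral>\<^sup>+y\<in>ball x r. w y + dual_weight p w y \<partial>lebesgue) < \<infinity>"
    using W S by (simp add: less_top)
  show "\<exists>c>0. AE y in lebesgue. y \<in> ball x r \<longrightarrow> ennreal c \<le> w y" if "p = 1"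
  proof -
    have "0 < ess_inf_on lebesgue (ball x r) w"
      using T0 that by (simp only: zero_less_iff_neq_zero if_True refl not_False_eq_True)
    then obtain c where c: "0 < c" "AE y in lebesgue. y \<in> ball x r \<longrightarrow> c \<le> w y"
      unfolding ess_inf_on_def less_Sup_iff by auto
    obtain d where d: "0 < d" "ennreal d \<le> c"
    proof (cases c)
      case (real a)
      then show ?thesis using c(1) that[of a] by simp
    next
      case top
      then show ?thesis using that[of 1] by simp
    qed
    have "AE y in lebesgue. y \<in> ball x r \<longrightarrow> ennreal d \<le> w y"
      using c(2) by eventually_elim (use d in \<open>auto intro: order_trans\<close>)
    with d show ?thesis by blast
  qed
qed

text \<open>By compactness finitely many of the local balls cover \<open>cball 0 N\<close>. A ball
  of radius at most the Lebesgue number \<open>\<epsilon>\<close> of this cover lies in one of them;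
  for larger balls the total integral over \<open>ball 0 N\<close> divided by the length is
  bounded.\<close>

lemma local_Ap_on_bounded_ball:
  assumes p: "1 \<le> p" and loc: "local_Ap_weight p w"
  obtains C c where "0 < C" "0 < c" "Ap_with C p w (ball 0 N)"
    "(\<integral>\<^sup>+y\<in>ball 0 N. w y + dual_weight p w y \<partial>lebesgue) < \<infinity>"
    "p = 1 \<Longrightarrow> AE y in lebesgue. y \<in> ball 0 N \<longrightarrow> ennreal c \<le> w y"
proof -
  have [measurable]: "w \<in> borel_measurable lebesgue"
    using loc by (simp add: local_Ap_weight_def weight_def)
  obtain R K where RK: "\<And>x. 0 < R x" "\<And>x. 0 < K x" "\<And>x. Ap_with (K x) p w (ball x (R x))"
    using loc unfolding local_Ap_weight_def holds_locally_def by metis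
  define f where "f y = w y + dual_weight p w y" for y
  have f[measurable]: "f \<in> borel_measurable lebesgue" unfolding f_def by measurable
  have Apb: "Ap_ball (K x) p w x (R x)" for x using RK by (auto simp: Ap_with_iff)
  have fin: "(\<integral>\<^sup>+y\<in>ball x (R x). f y \<partial>lebesgue) < \<infinity>" for x
    unfolding f_def by (rule Ap_ball_finite(1)[OF Apb p RK(1)]) fact
  have "\<exists>c>0. p = 1 \<longrightarrow> (AE y in lebesgue. y \<in> ball x (R x) \<longrightarrow> ennreal c \<le> w y)" for x
    using Ap_ball_finite(2)[OF Apb p RK(1), of x] zero_less_one \<open>w \<in> _\<close> by (cases "p = 1") (auto intro: exI[of _ 1])
  then obtain c where c: "\<And>x. 0 < c x" "\<And>x. p = 1 \<Longrightarrow> AE y in lebesgue. y \<in> ball x (R x) \<longrightarrow> ennreal (c x) \<le> w y"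
    by metis
  obtain D where D: "finite D" "cball 0 N \<subseteq> (\<Union>x\<in>D. ball x (R x))"
  proof (rule compactE_image[OF compact_cball, of UNIV "\<lambda>x. ball x (R x)" 0 N])
    show "cball 0 N \<subseteq> (\<Union>x. ball x (R x))" using RK(1) centre_in_ball by blast
  qed auto
  obtain \<epsilon> where \<epsilon>: "0 < \<epsilon>" "\<And>x. x \<in> cball 0 N \<Longrightarrow> \<exists>z\<in>D. ball x \<epsilon> \<subseteq> ball z (R z)"
    using Heine_Borel_lemma[OF compact_cball, of 0 N "(\<lambda>x. ball x (R x)) ` D"] D(2) by auto
  have ballN: "ball 0 N \<subseteq> (\<Union>x\<in>D. ball x (R x))" using D(2) ball_subset_cball by blast
  \<comment> \<open>The element 1 keeps \<open>Min\<close> meaningful when \<open>D\<close> is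
    empty.\<close>
  define c0 where "c0 = Min (insert 1 (c ` D))"
  have c0: "0 < c0" "\<And>x. x \<in> D \<Longrightarrow> c0 \<le> c x"
    using D(1) c(1) by (auto simp: c0_def)
  have AEc: "AE y in lebesgue. y \<in> ball 0 N \<longrightarrow> ennreal c0 \<le> w y" if "p = 1"
  proof -
    have "AE y in lebesgue. \<forall>x\<in>D. y \<in> ball x (R x) \<longrightarrow> ennreal (c x) \<le> w y"
      by (rule AE_finite_allI[OF D(1)]) (rule c(2)[OF that])
    then show ?thesis
    proof eventually_elim
      case (elim y)
      show ?case
      proof
        assume "y \<in> ball 0 N"
        then obtain x where "x \<in> D" "y \<in> ball x (R x)" using ballN by blast
        then show "ennreal c0 \<le> w y" using elim c0(2)[of x] by (meson ennreal_leI order_trans)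
      qed
    qed
  qed
  have finN: "(\<integral>\<^sup>+y\<in>ball 0 N. f y \<partial>lebesgue) < \<infinity>"
  proof -
    have e: "emeasure (density lebesgue f) A = (\<integral>\<^sup>+y\<in>A. f y \<partial>lebesgue)" if "A \<in> sets borel" for A
      using that by (intro emeasure_density f) auto
    have "(\<integral>\<^sup>+y\<in>ball 0 N. f y \<partial>lebesgue) \<le> emeasure (density lebesgue f) (\<Union>x\<in>D. ball x (R x))"
    proof (subst e[symmetric])
      have "(\<Union>x\<in>D. ball x (R x)) \<in> sets borel" by (intro borel_open open_UN) simp
      then show "emeasure (density lebesgue f) (ball 0 N) \<le> emeasure (density lebesgue f) (\<Union>x\<in>D. ball x (R x))"
        by (intro emeasure_mono[OF ballN]) simp
    qed simp
    also have "\<dots> \<le> (\<Sum>x\<in>D. emeasure (density lebesgue f) (ball x (R x)))"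
      using D(1) by (intro emeasure_subadditive_finite) auto
    also have "\<dots> < \<infinity>" using fin D(1) by (simp add: e)
    finally show ?thesis .
  qed
  obtain F where F: "0 \<le> F" "(\<integral>\<^sup>+y\<in>ball 0 N. f y \<partial>lebesgue) = ennreal F"
    using finN by (cases "\<integral>\<^sup>+y\<in>ball 0 N. f y \<partial>lebesgue") auto
  \<comment> \<open>Balls of radius above \<open>\<epsilon>\<close> are longer than
    \<open>2 * \<epsilon>\<close>, so \<open>a\<close> bounds the averages of \<open>f\<close> on
    them; adding 1 keeps it positive.\<close>
  define a where "a = (F + 1) / (2 * \<epsilon>)"
  have a: "0 < a" using F \<epsilon> by (simp add: a_def)
  \<comment> \<open>The factor 2 makes the inequality required by \<open>Ap_ballI\<close>
    strict.\<close>
  define C2 where "C2 = 2 * a / (if p = 1 then c0 else a powr (1 - p))"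
  have C2: "0 < C2" using a c0 by (simp add: C2_def)
  define C where "C = C2 + (\<Sum>x\<in>D. K x)"
  have KD: "0 \<le> (\<Sum>x\<in>D. K x)" using RK(2) by (intro sum_nonneg) (simp add: less_imp_le)
  have C: "0 < C" using C2 KD by (simp add: C_def)
  have "Ap_ball C p w x r" if r: "0 < r" "ball x r \<subseteq> ball 0 N" for x r
  proof (cases "r \<le> \<epsilon>")
    case True
    have "x \<in> cball 0 N" using r ball_subset_cball[of 0 N] centre_in_ball[of x r] by blast
    then obtain z where z: "z \<in> D" "ball x \<epsilon> \<subseteq> ball z (R z)" using \<epsilon>(2) by blast
    then have "Ap_ball (K z) p w x r"
      using RK(3)[of z] r subset_ball[OF True, of x] unfolding Ap_with_iff by blast
    moreover have "K z \<le> C"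
      using member_le_sum[OF z(1), of K] D(1) RK(2) C2 by (auto simp: C_def less_imp_le intro: add_increasing)
    ultimately show ?thesis by (rule Ap_ball_mono)
  next
    case False
    have le: "(\<integral>\<^sup>+y\<in>ball x r. h y \<partial>lebesgue) \<le> ennreal (a * (2 * r))" if h: "\<And>y. h y \<le> f y" for h
    proof -
      have "(\<integral>\<^sup>+y\<in>ball x r. h y \<partial>lebesgue) \<le> (\<integral>\<^sup>+y\<in>ball 0 N. f y \<partial>lebesgue)"
        using r h by (intro nn_integral_mono) (auto simp: indicator_def)
      also have "\<dots> \<le> ennreal (a * (2 * r))"
      proof -
        have "F \<le> a * (2 * \<epsilon>)" using \<epsilon> by (simp add: a_def)
        also have "\<dots> \<le> a * (2 * r)" using False a by simp
        finally show ?thesis unfolding F(2) by (rule ennreal_leI)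
      qed
      finally show ?thesis .
    qed
    show ?thesis
    proof (rule Ap_ballI[OF p r(1) a a C])
      show "(\<integral>\<^sup>+y\<in>ball x r. w y \<partial>lebesgue) \<le> ennreal (a * (2 * r))"
        by (rule le) (simp add: f_def)
      show "(\<integral>\<^sup>+y\<in>ball x r. enn_powr (w y) (1 / (1 - p)) \<partial>lebesgue) \<le> ennreal (a * (2 * r))" if "p \<noteq> 1"
        by (rule le) (simp add: f_def dual_weight_def that)
      show "AE y in lebesgue. y \<in> ball x r \<longrightarrow> ennreal c0 \<le> w y" if "p = 1"
        using AEc[OF that] by eventually_elim (use r in blast)
      have "a < C2 * (if p = 1 then c0 else a powr (1 - p))" using a c0 by (simp add: C2_def)
      also have "\<dots> \<le> C * (if p = 1 then c0 else a powr (1 - p))"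
        using KD c0 by (intro mult_right_mono) (auto simp: C_def)
      finally show "a < C * (if p = 1 then c0 else a powr (1 - p))" .
    qed (rule c0)
  qed
  then show ?thesis
    using that[OF C c0(1)] finN AEc by (auto simp: Ap_with_iff f_def)
qed

text \<open>The point \<open>b\<close> is where \<open>K x - F x\<close> attains its maximum over \<open>[n, \<beta>]\<close>.\<close>

lemma bounded_left_difference_quotient:
  fixes F :: "real \<Rightarrow> real"
  assumes cont: "continuous_on {\<alpha>..\<beta>} F" and mono: "mono_on {\<alpha>..\<beta>} F" and n: "\<alpha> \<le> n" "n < \<beta>"
  obtains b K where "n < b" "b \<le> \<beta>" "0 < K" "\<And>x. \<alpha> \<le> x \<Longrightarrow> x \<le> b \<Longrightarrow> F b - F x \<le> K * (b - x)"
proof -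
  \<comment> \<open>\<open>K\<close> exceeds the slope of \<open>F\<close> from \<open>n\<close> to
    \<open>\<beta>\<close>, so that \<open>G n < G \<beta>\<close> and the maximum is not attained
    at \<open>n\<close>.\<close>
  define K where "K = (F \<beta> - F n) / (\<beta> - n) + 1"
  have Fn: "F n \<le> F \<beta>" using mono n by (auto intro: mono_onD)
  then have K: "0 < K" using n by (simp add: K_def add_nonneg_pos)
  define G where "G x = K * x - F x" for x
  have "continuous_on {n..\<beta>} G"
    unfolding G_def using n by (intro continuous_intros continuous_on_subset[OF cont]) auto
  then obtain b where b: "b \<in> {n..\<beta>}" "\<And>x. x \<in> {n..\<beta>} \<Longrightarrow> G x \<le> G b"
    using continuous_attains_sup[of "{n..\<beta>}" G] n by auto
  have "G n < G \<beta>"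
  proof -
    have "K * (\<beta> - n) = F \<beta> - F n + (\<beta> - n)" using n by (simp add: K_def field_simps)
    then show ?thesis using n by (simp add: G_def algebra_simps)
  qed
  then have "n < b" using b(1) b(2)[of \<beta>] n by (cases "b = n") auto
  \<comment> \<open>Left of \<open>n\<close> the maximality at \<open>b\<close> gives no
    information; there the increase of \<open>F\<close> from \<open>\<alpha>\<close> to
    \<open>b\<close> is spread over a distance of at least \<open>b - n\<close>.\<close>
  define K' where "K' = K + (F b - F \<alpha>) / (b - n)"
  have F\<alpha>: "F \<alpha> \<le> F b" using mono n b \<open>n < b\<close> by (auto intro: mono_onD)
  have KK': "K \<le> K'" using F\<alpha> \<open>n < b\<close> by (simp add: K'_def)
  show ?thesis
  proof (rule that[OF \<open>n < b\<close>])
    show "b \<le> \<beta>" using b by simp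
    show "0 < K'" using K KK' by simp
    fix x assume x: "\<alpha> \<le> x" "x \<le> b"
    show "F b - F x \<le> K' * (b - x)"
    proof (cases "n \<le> x")
      case True
      then have "F b - F x \<le> K * (b - x)" using b(1) b(2)[of x] x by (simp add: G_def algebra_simps)
      also have "\<dots> \<le> K' * (b - x)" using KK' x by (intro mult_right_mono) auto
      finally show ?thesis .
    next
      case False
      have "F \<alpha> \<le> F x" using mono x b n by (auto intro!: mono_onD[OF mono])
      then have "F b - F x \<le> (F b - F \<alpha>) / (b - n) * (b - n)" using \<open>n < b\<close> by simp
      also have "\<dots> \<le> K' * (b - x)"
        using False F\<alpha> \<open>n < b\<close> K by (intro mult_mono) (auto simp: K'_def)
      finally show ?thesis .
    qed
  qed
qed

text \<open>The mirror image: \<open>bounded_left_difference_quotient\<close> is applied to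
  \<open>- F (- x)\<close>.\<close>

lemma bounded_right_difference_quotient:
  fixes F :: "real \<Rightarrow> real"
  assumes cont: "continuous_on {\<alpha>..\<beta>} F" and mono: "mono_on {\<alpha>..\<beta>} F" and n: "\<alpha> < n" "n \<le> \<beta>"
  obtains a K where "\<alpha> \<le> a" "a < n" "0 < K" "\<And>x. a \<le> x \<Longrightarrow> x \<le> \<beta> \<Longrightarrow> F x - F a \<le> K * (x - a)"
proof -
  have "continuous_on {-\<beta>..-\<alpha>} (\<lambda>x. - F (- x))"
    by (intro continuous_intros continuous_on_compose2[OF cont]) auto
  moreover have "mono_on {-\<beta>..-\<alpha>} (\<lambda>x. - F (- x))"
    by (intro mono_onI) (auto intro!: mono_onD[OF mono])
  ultimately obtain b K where b: "-n < b" "b \<le> -\<alpha>" "0 < K"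
    "\<And>x. -\<beta> \<le> x \<Longrightarrow> x \<le> b \<Longrightarrow> - F (- b) - - F (- x) \<le> K * (b - x)"
    using bounded_left_difference_quotient[of "-\<beta>" "-\<alpha>" "\<lambda>x. - F (- x)" "-n"] n by auto
  show ?thesis
  proof (rule that[of "- b" K])
    show "F x - F (- b) \<le> K * (x - - b)" if "- b \<le> x" "x \<le> \<beta>" for x
      using b(4)[of "- x"] that by (simp add: algebra_simps)
  qed (use b in auto)
qed

text \<open>\<open>F\<close> is an indefinite integral of the finite-valued version \<open>h\<close>
  of \<open>f\<close>; the two agree almost everywhere on the interval because the integral is
  finite.\<close>

lemma nn_integral_eq_increment:
  fixes f :: "real \<Rightarrow> ennreal"
  assumes f[measurable]: "f \<in> borel_measurable lebesgue"
    and fin: "(\<integral>\<^sup>+y\<in>{\<alpha>..\<beta>}. f y \<partial>lebesgue) < \<infinity>"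
  obtains F where "continuous_on {\<alpha>..\<beta>} F" "mono_on {\<alpha>..\<beta>} F"
    "\<And>x y. \<alpha> \<le> x \<Longrightarrow> x \<le> y \<Longrightarrow> y \<le> \<beta> \<Longrightarrow> (\<integral>\<^sup>+t\<in>{x<..<y}. f t \<partial>lebesgue) = ennreal (F y - F x)"
proof -
  define h where "h y = enn2real (f y)" for y
  have h0: "0 \<le> h y" for y by (simp add: h_def)
  have [measurable]: "{x<..<y} \<in> sets lebesgue" "{x..y} \<in> sets lebesgue" for x y :: real by auto
  have hm[measurable]: "h \<in> borel_measurable lebesgue" unfolding h_def by measurable
  have "AE y in lebesgue. f y * indicator {\<alpha>..\<beta>} y \<noteq> \<infinity>"
    using fin by (intro nn_integral_PInf_AE) auto
  then have ae: "AE y in lebesgue. y \<in> {\<alpha>..\<beta>} \<longrightarrow> f y = ennreal (h y)"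
    by eventually_elim (auto simp: h_def less_top)
  have int: "set_integrable lebesgue {\<alpha>..\<beta>} h"
    unfolding set_integrable_def
  proof (rule integrableI_bounded)
    have "(\<integral>\<^sup>+y. ennreal (norm (indicat_real {\<alpha>..\<beta>} y *\<^sub>R h y)) \<partial>lebesgue) \<le> (\<integral>\<^sup>+y\<in>{\<alpha>..\<beta>}. f y \<partial>lebesgue)"
      by (intro nn_integral_mono) (auto simp: indicator_def h_def ennreal_enn2real_if)
    then show "(\<integral>\<^sup>+y. ennreal (norm (indicat_real {\<alpha>..\<beta>} y *\<^sub>R h y)) \<partial>lebesgue) < \<infinity>"
      using fin by (rule le_less_trans)
  qed measurable
  have int_sub: "set_integrable lebesgue A h" if "A \<in> sets lebesgue" "A \<subseteq> {\<alpha>..\<beta>}" for A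
    by (rule set_integrable_subset[OF int]) (use that in auto)
  define F where "F x = integral {\<alpha>..x} h" for x
  have inc: "F y = F x + integral {x..y} h" if "\<alpha> \<le> x" "x \<le> y" "y \<le> \<beta>" for x y
  proof -
    have "h integrable_on {\<alpha>..y}"
      using int_sub[of "{\<alpha>..y}"] that by (intro set_lebesgue_integral_eq_integral(1)) auto
    then show ?thesis unfolding F_def using that by (simp add: Henstock_Kurzweil_Integration.integral_combine)
  qed
  have I: "(\<integral>\<^sup>+t\<in>{x<..<y}. f t \<partial>lebesgue) = ennreal (integral {x..y} h)" if "\<alpha> \<le> x" "x \<le> y" "y \<le> \<beta>" for x y
  proof -
    have int_xy: "set_integrable lebesgue {x<..<y} h" by (rule int_sub) (use that in auto)
    have "(\<integral>\<^sup>+t\<in>{x<..<y}. f t \<partial>lebesgue) = (\<integral>\<^sup>+t. ennreal (indicat_real {x<..<y} t *\<^sub>R h t) \<partial>lebesgue)"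
    proof (rule nn_integral_cong_AE, use ae in eventually_elim)
      case (elim t)
      then show ?case using that by (auto simp: indicator_def)
    qed
    also have "\<dots> = ennreal (LINT t:{x<..<y}|lebesgue. h t)"
      unfolding set_lebesgue_integral_def
      by (rule nn_integral_eq_integral[OF int_xy[unfolded set_integrable_def]]) (auto simp: h0)
    also have "(LINT t:{x<..<y}|lebesgue. h t) = integral {x<..<y} h"
      by (rule set_lebesgue_integral_eq_integral(2)[OF int_xy])
    also have "\<dots> = integral {x..y} h" by (simp add: integral_open_interval_real)
    finally show ?thesis .
  qed
  show ?thesis
  proof
    show "continuous_on {\<alpha>..\<beta>} F" unfolding F_def
      using set_lebesgue_integral_eq_integral(1)[OF int] by (rule indefinite_integral_continuous_1)
    show "mono_on {\<alpha>..\<beta>} F"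
    proof (rule mono_onI)
      fix x y assume xy: "x \<in> {\<alpha>..\<beta>}" "y \<in> {\<alpha>..\<beta>}" "x \<le> y"
      then have "h integrable_on {x..y}"
        using int_sub[of "{x..y}"] by (intro set_lebesgue_integral_eq_integral(1)) auto
      then have "0 \<le> integral {x..y} h"
        using h0 by (intro Henstock_Kurzweil_Integration.integral_nonneg) auto
      then show "F x \<le> F y" using inc[of x y] xy by simp
    qed
    show "(\<integral>\<^sup>+t\<in>{x<..<y}. f t \<partial>lebesgue) = ennreal (F y - F x)" if "\<alpha> \<le> x" "x \<le> y" "y \<le> \<beta>" for x y
      using I[OF that] inc[OF that] by simp
  qed
qed

section \<open>Gluing a local weight to the constant 1\<close>

text \<open>A ball that meets \<open>J = (a, b)\<close> without lying in it overlaps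
  \<open>J\<close> in an interval reaching \<open>a\<close> or \<open>b\<close>. These ends are
  chosen so that the integral of \<open>f\<close> over every such interval is at most
  \<open>K\<close> times its length, which controls balls of all sizes.\<close>

lemma local_Ap_extends:
  fixes I :: "real set"
  assumes p: "1 \<le> p" and loc: "local_Ap_weight p w" and I: "bounded I"
  obtains w' where "global_Ap_weight p w'" "\<And>x. x \<in> I \<Longrightarrow> w' x = w x"
proof -
  have w[measurable]: "w \<in> borel_measurable lebesgue"
    using loc by (simp add: local_Ap_weight_def weight_def)
  obtain n where n: "0 < n" "\<And>x. x \<in> I \<Longrightarrow> \<bar>x\<bar> \<le> n"
    using I unfolding bounded_pos by (auto simp: real_norm_def)
  define f where "f y = w y + dual_weight p w y" for y
  have f[measurable]: "f \<in> borel_measurable lebesgue" unfolding f_def by measurable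
  \<comment> \<open>Radius \<open>n + 2\<close> leaves a margin: \<open>a\<close> will lie in
    \<open>[-(n + 1), -n)\<close> and \<open>b\<close> in \<open>(n, n + 1]\<close>, so
    \<open>J\<close> contains \<open>I\<close> and stays inside this ball.\<close>
  obtain C c where C: "0 < C" "0 < c" "Ap_with C p w (ball 0 (n + 2))"
    "(\<integral>\<^sup>+y\<in>ball 0 (n + 2). f y \<partial>lebesgue) < \<infinity>"
    "p = 1 \<Longrightarrow> AE y in lebesgue. y \<in> ball 0 (n + 2) \<longrightarrow> ennreal c \<le> w y"
    using local_Ap_on_bounded_ball[OF p loc, of "n + 2"] unfolding f_def by blast
  have fin: "(\<integral>\<^sup>+y\<in>{-(n+1)..n+1}. f y \<partial>lebesgue) < \<infinity>"
  proof -
    have "(\<integral>\<^sup>+y\<in>{-(n+1)..n+1}. f y \<partial>lebesgue) \<le> (\<integral>\<^sup>+y\<in>ball 0 (n + 2). f y \<partial>lebesgue)"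
      by (intro nn_integral_mono) (auto simp: indicator_def)
    then show ?thesis using C(4) by (rule le_less_trans)
  qed
  obtain F where F: "continuous_on {-(n+1)..n+1} F" "mono_on {-(n+1)..n+1} F"
    "\<And>x y. -(n+1) \<le> x \<Longrightarrow> x \<le> y \<Longrightarrow> y \<le> n+1 \<Longrightarrow> (\<integral>\<^sup>+t\<in>{x<..<y}. f t \<partial>lebesgue) = ennreal (F y - F x)"
    using nn_integral_eq_increment[OF f fin] by blast
  obtain b Kb where b: "n < b" "b \<le> n + 1" "0 < Kb"
    "\<And>x. -(n+1) \<le> x \<Longrightarrow> x \<le> b \<Longrightarrow> F b - F x \<le> Kb * (b - x)"
    using bounded_left_difference_quotient[OF F(1,2), of n] n(1) by auto
  obtain a Ka where a: "-(n+1) \<le> a" "a < - n" "0 < Ka"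
    "\<And>x. a \<le> x \<Longrightarrow> x \<le> n + 1 \<Longrightarrow> F x - F a \<le> Ka * (x - a)"
    using bounded_right_difference_quotient[OF F(1,2), of "- n"] n(1) by auto
  define K where "K = max Ka Kb"
  have K: "0 < K" "Ka \<le> K" "Kb \<le> K" using a b by (auto simp: K_def)
  have ab: "a < b" using a b n by simp
  define J where "J = {a<..<b}"
  have J: "J \<subseteq> ball 0 (n + 2)" using a b by (auto simp: J_def)
  have Jm[measurable]: "J \<in> sets lebesgue" by (auto simp: J_def)
  define w' where "w' x = (if x \<in> J then w x else 1)" for x
  have w'[measurable]: "w' \<in> borel_measurable lebesgue" unfolding w'_def by measurable
  have edge: "(\<integral>\<^sup>+y\<in>ball x r \<inter> J. f y \<partial>lebesgue) \<le> ennreal (K * (2 * r))" if r: "0 < r" "\<not> ball x r \<subseteq> J" for x r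
  proof (cases "ball x r \<inter> J = {}")
    case False
    define s t where "s = max a (x - r)" and "t = min b (x + r)"
    have P: "ball x r \<inter> J = {s<..<t}" by (auto simp: s_def t_def J_def ball_eq_greaterThanLessThan)
    have st: "s < t" using False unfolding P by simp
    have range: "a \<le> s" "t \<le> b" "t - s \<le> 2 * r" by (auto simp: s_def t_def)
    have "s = a \<or> t = b" using r(2) by (auto simp: s_def t_def J_def ball_eq_greaterThanLessThan max_def min_def)
    then have "F t - F s \<le> K * (t - s)"
    proof
      assume "s = a"
      then have "F t - F s \<le> Ka * (t - s)" using a(4)[of t] st range b by simp
      also have "\<dots> \<le> K * (t - s)" using K st by (intro mult_right_mono) auto
      finally show ?thesis .
    next
      assume "t = b"
      then have "F t - F s \<le> Kb * (t - s)" using b(4)[of s] st range a by simp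
      also have "\<dots> \<le> K * (t - s)" using K st by (intro mult_right_mono) auto
      finally show ?thesis .
    qed
    also have "\<dots> \<le> K * (2 * r)" using K range by (intro mult_left_mono) auto
    finally have "ennreal (F t - F s) \<le> ennreal (K * (2 * r))" by (rule ennreal_leI)
    then show ?thesis unfolding P using F(3)[of s t] a b range st by simp
  qed simp
  \<comment> \<open>\<open>K\<close> accounts for the part of a ball in \<open>J\<close>, and 1 for
    the rest, where \<open>w'\<close> and its dual power equal 1.\<close>
  define A where "A = K + 1"
  have A: "0 < A" using K by (simp add: A_def)
  define c' where "c' = min c 1"
  have c': "0 < c'" using C by (simp add: c'_def)
  \<comment> \<open>\<open>C\<close> serves the balls inside \<open>J\<close>, the second summand
    the others, again with a factor 2 for strictness.\<close>
  define C' where "C' = C + 2 * A / (if p = 1 then c' else A powr (1 - p))"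
  have C': "0 < C'" "C \<le> C'" using C(1) A c' by (auto simp: C'_def intro: add_pos_nonneg)
  have "Ap_ball C' p w' x r" if r: "0 < r" for x r
  proof (cases "ball x r \<subseteq> J")
    case True
    have "Ap_with C p w J" using C(3) J unfolding Ap_with_iff by blast
    then have "Ap_with C p w' J" using Ap_with_cong[of J w w' C p] by (simp add: w'_def)
    then have "Ap_ball C p w' x r" using True r unfolding Ap_with_iff by blast
    then show ?thesis using C'(2) by (rule Ap_ball_mono)
  next
    case False
    have [measurable]: "ball x r \<in> sets lebesgue" by auto
    have le: "(\<integral>\<^sup>+y\<in>ball x r. h y \<partial>lebesgue) \<le> ennreal (A * (2 * r))"
      if h: "\<And>y. y \<in> J \<Longrightarrow> h y \<le> f y" "\<And>y. y \<notin> J \<Longrightarrow> h y \<le> 1" for h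
    proof -
      have "(\<integral>\<^sup>+y\<in>ball x r. h y \<partial>lebesgue)
          \<le> (\<integral>\<^sup>+y. f y * indicator (ball x r \<inter> J) y + indicator (ball x r) y \<partial>lebesgue)"
        using h by (intro nn_integral_mono) (auto simp: indicator_def intro: add_increasing2)
      also have "\<dots> = (\<integral>\<^sup>+y\<in>ball x r \<inter> J. f y \<partial>lebesgue) + emeasure lebesgue (ball x r)"
        by (subst nn_integral_add) auto
      also have "\<dots> \<le> ennreal (K * (2 * r)) + ennreal (2 * r)"
        using edge[OF r False] r by (intro add_mono) (auto simp: emeasure_lborel_ball)
      also have "\<dots> = ennreal (A * (2 * r))"
        using r K by (simp add: A_def distrib_right flip: ennreal_plus)
      finally show ?thesis .
    qed
    show ?thesis
    proof (rule Ap_ballI[OF p r A A C'(1)])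
      show "(\<integral>\<^sup>+y\<in>ball x r. w' y \<partial>lebesgue) \<le> ennreal (A * (2 * r))"
        by (rule le) (simp_all add: w'_def f_def)
      show "(\<integral>\<^sup>+y\<in>ball x r. enn_powr (w' y) (1 / (1 - p)) \<partial>lebesgue) \<le> ennreal (A * (2 * r))" if "p \<noteq> 1"
        by (rule le) (simp_all add: w'_def f_def dual_weight_def that)
      show "AE y in lebesgue. y \<in> ball x r \<longrightarrow> ennreal c' \<le> w' y" if "p = 1"
        using C(5)[OF that]
      proof eventually_elim
        case (elim y)
        have "ennreal c' \<le> ennreal c" "ennreal c' \<le> ennreal 1" by (auto simp: c'_def intro!: ennreal_leI)
        then show ?case using elim J by (auto simp: w'_def intro: order_trans)
      qed
      have "A < 2 * A / (if p = 1 then c' else A powr (1 - p)) * (if p = 1 then c' else A powr (1 - p))"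
        using A c' by simp
      also have "\<dots> \<le> C' * (if p = 1 then c' else A powr (1 - p))"
        using C(1) c' by (intro mult_right_mono) (auto simp: C'_def)
      finally show "A < C' * (if p = 1 then c' else A powr (1 - p))" .
    qed (rule c')
  qed
  then have "Ap_with C' p w' (ball x R)" for x R by (simp add: Ap_with_iff)
  then have "global_Ap_weight p w'"
    unfolding global_Ap_weight_def weight_def using C'(1) w' by blast
  moreover have "w' x = w x" if "x \<in> I" for x
    using n(2)[OF that] a b by (auto simp: w'_def J_def)
  ultimately show ?thesis using that by blast
qed

theorem theorem1p2:
  fixes p :: real and \<mu> :: "real measure"
  assumes "1 \<le> p" and "line_measure \<mu>"
  shows "(locally_admissible p \<mu> \<longleftrightarrow> (\<exists>w. has_weight \<mu> w \<and> local_Ap_weight p w)) \<and>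
    ((\<exists>w. has_weight \<mu> w \<and> local_Ap_weight p w) \<longleftrightarrow>
      (\<exists>w. weight w \<and> has_weight \<mu> w \<and>
        (\<forall>I. is_interval I \<and> bounded I \<longrightarrow>
          (\<exists>w'. global_Ap_weight p w' \<and> (\<forall>x\<in>I. w' x = w x)))))"
proof (intro conjI iffI)
  assume "locally_admissible p \<mu>"
  then show "\<exists>w. has_weight \<mu> w \<and> local_Ap_weight p w"
    by (rule locally_admissible_imp_local_Ap[OF assms])
next
  assume "\<exists>w. has_weight \<mu> w \<and> local_Ap_weight p w"
  then show "locally_admissible p \<mu>"
    using local_Ap_imp_locally_admissible[OF assms] by blast
next
  assume "\<exists>w. has_weight \<mu> w \<and> local_Ap_weight p w"
  then obtain w where w: "has_weight \<mu> w" "local_Ap_weight p w" by blast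
  then have "weight w" by (simp add: local_Ap_weight_def)
  moreover have "\<exists>w'. global_Ap_weight p w' \<and> (\<forall>x\<in>I. w' x = w x)" if "bounded I" for I
    using local_Ap_extends[OF assms(1) w(2) that] by metis
  ultimately show "\<exists>w. weight w \<and> has_weight \<mu> w \<and>
        (\<forall>I. is_interval I \<and> bounded I \<longrightarrow>
          (\<exists>w'. global_Ap_weight p w' \<and> (\<forall>x\<in>I. w' x = w x)))"
    using w(1) by blast
next
  assume "\<exists>w. weight w \<and> has_weight \<mu> w \<and>
        (\<forall>I. is_interval I \<and> bounded I \<longrightarrow>
          (\<exists>w'. global_Ap_weight p w' \<and> (\<forall>x\<in>I. w' x = w x)))"
  then obtain w where w: "weight w" "has_weight \<mu> w"
    and ext: "\<And>I. is_interval I \<Longrightarrow> bounded I \<Longrightarrow> \<exists>w'. global_Ap_weight p w' \<and> (\<forall>x\<in>I. w' x = w x)"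
    by blast
  show "\<exists>w. has_weight \<mu> w \<and> local_Ap_weight p w"
    using local_Ap_if_extends[OF w(1) ext] w(2) by blast
qed

end
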